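(* Let $G$ be a finite simple 2-degenerate graph with maximum degree $\Delta$. Then $a'(G)\le \Delta+1$; that is, $G$ has an acyclic edge coloring using at most $\Delta+1$ colors.
   Context: All graphs are finite and simple. A graph $G$ is called $k$-degenerate if every (nonempty) induced subgraph of $G$ has a vertex of degree at most $k$ (the degree being taken in that induced subgraph). A proper edge coloring of $G=(V,E)$ is a map $c:E\to C$, where $C$ is a set of colors, with $c(e)\neq c(f)$ for any two adjacent edges $e,f$. A proper edge coloring is acyclic if there is no bichromatic cycle in $G$, i.e. no cycle whose edges use only two colors; equivalently, the union of any two color classes induces a linear forest (a disjoint union of paths). The acyclic chromatic index $a'(G)$ is the minimum number of colors needed in an acyclic edge coloring of $G$. *)

theory Defs
  imports Main
begin

locale finite_simple_graph =
  fixes V :: "'a set" and E :: "'a set set"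
  assumes finite_V: "finite V"
    and edges: "\<And>e. e \<in> E \<Longrightarrow> e \<subseteq> V \<and> card e = 2"

lemma (in finite_simple_graph) finite_E: "finite E"
  using finite_V edges by (meson PowI finite_Pow_iff finite_subset subsetI)

definition degree :: "'a set set \<Rightarrow> 'a \<Rightarrow> nat" where
  "degree E v = card {e \<in> E. v \<in> e}"

text \<open>The inserted 0 only matters for the graph without vertices, whose maximum degree is 0
  by convention.\<close>

definition max_degree :: "'a set \<Rightarrow> 'a set set \<Rightarrow> nat" where
  "max_degree V E = Max (insert 0 (degree E ` V))"

definition induced_edges :: "'a set set \<Rightarrow> 'a set \<Rightarrow> 'a set set" where
  "induced_edges E S = {e \<in> E. e \<subseteq> S}"

definition degenerate :: "nat \<Rightarrow> 'a set \<Rightarrow> 'a set set \<Rightarrow> bool" where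
  "degenerate k V E \<longleftrightarrow>
     (\<forall>S. S \<subseteq> V \<and> S \<noteq> {} \<longrightarrow> (\<exists>v\<in>S. degree (induced_edges E S) v \<le> k))"

text \<open>A cycle is given by the list of its vertices in cyclic order, without repeating the
  first vertex at the end.\<close>

definition cycle_edges :: "'a list \<Rightarrow> 'a set set" where
  "cycle_edges p = {{p ! i, p ! (Suc i mod length p)} | i. i < length p}"

definition is_cycle :: "'a set set \<Rightarrow> 'a list \<Rightarrow> bool" where
  "is_cycle E p \<longleftrightarrow> 3 \<le> length p \<and> distinct p \<and> cycle_edges p \<subseteq> E"

definition proper_edge_coloring :: "'a set set \<Rightarrow> 'c set \<Rightarrow> ('a set \<Rightarrow> 'c) \<Rightarrow> bool" where
  "proper_edge_coloring E C c \<longleftrightarrow>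
     c ` E \<subseteq> C \<and> (\<forall>e\<in>E. \<forall>f\<in>E. e \<noteq> f \<and> e \<inter> f \<noteq> {} \<longrightarrow> c e \<noteq> c f)"

definition bichromatic :: "('a set \<Rightarrow> 'c) \<Rightarrow> 'a list \<Rightarrow> bool" where
  "bichromatic c p \<longleftrightarrow> card (c ` cycle_edges p) \<le> 2"

definition acyclic_edge_coloring :: "'a set set \<Rightarrow> 'c set \<Rightarrow> ('a set \<Rightarrow> 'c) \<Rightarrow> bool" where
  "acyclic_edge_coloring E C c \<longleftrightarrow>
     proper_edge_coloring E C c \<and> \<not> (\<exists>p. is_cycle E p \<and> bichromatic c p)"

text \<open>Only the number of colors matters, so the color set is taken to be an initial segment
  of the natural numbers. The minimum is attained, see \<open>acyclic_chromatic_index_attained\<close>.\<close>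

definition acyclic_chromatic_index :: "'a set set \<Rightarrow> nat" where
  "acyclic_chromatic_index E = (LEAST k. \<exists>c. acyclic_edge_coloring E {..<k} c)"

lemma finite_cycle_edges: "finite (cycle_edges p)"
  unfolding cycle_edges_def by simp

lemma card_cycle_edges_ge_3:
  assumes "3 \<le> length p" "distinct p"
  shows "3 \<le> card (cycle_edges p)"
proof -
  let ?n = "length p"
  let ?a = "{p ! 0, p ! 1}" and ?b = "{p ! 1, p ! 2}" and ?c = "{p ! 2, p ! (3 mod ?n)}"
  have m: "3 mod ?n = 0 \<or> 3 mod ?n = 3"
    using assms(1) by (cases "?n = 3") auto
  have mn: "3 mod ?n < ?n"
    using assms(1) by (intro mod_less_divisor) linarith
  have d: "p ! i = p ! j \<longleftrightarrow> i = j" if "i < ?n" "j < ?n" for i j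
    using assms(2) that by (rule nth_eq_iff_index_eq)
  have n: "0 < ?n" "1 < ?n" "2 < ?n" using assms(1) by auto
  have ne: "p ! 0 \<noteq> p ! 1" "p ! 0 \<noteq> p ! 2" "p ! 1 \<noteq> p ! 2" "p ! 1 \<noteq> p ! (3 mod ?n)"
    using d n mn m by auto
  have mem: "{p ! i, p ! (Suc i mod ?n)} \<in> cycle_edges p" if "i < ?n" for i
    using that unfolding cycle_edges_def by blast
  have sub: "{?a, ?b, ?c} \<subseteq> cycle_edges p"
    using mem[of 0] mem[of 1] mem[of 2] n by (simp add: numeral_3_eq_3 numeral_2_eq_2)
  have "?a \<noteq> ?b" "?a \<noteq> ?c" "?b \<noteq> ?c"
    using ne by (auto simp: doubleton_eq_iff)
  then have "card {?a, ?b, ?c} = 3"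
    by simp
  then show ?thesis
    using card_mono[OF finite_cycle_edges sub] by simp
qed

lemma (in finite_simple_graph) acyclic_chromatic_index_attained:
  "\<exists>c. acyclic_edge_coloring E {..<acyclic_chromatic_index E} c"
proof -
  obtain c :: "'a set \<Rightarrow> nat" and k where c: "c ` E = {..<k}" "inj_on c E"
    using finite_imp_inj_to_nat_seg[OF finite_E] by (auto simp: lessThan_def)
  have "acyclic_edge_coloring E {..<k} c"
    unfolding acyclic_edge_coloring_def proper_edge_coloring_def
  proof (intro conjI notI)
    show "c ` E \<subseteq> {..<k}" using c by simp
    show "\<forall>e\<in>E. \<forall>f\<in>E. e \<noteq> f \<and> e \<inter> f \<noteq> {} \<longrightarrow> c e \<noteq> c f"
      using c(2) by (auto dest: inj_onD)
  next
    assume "\<exists>p. is_cycle E p \<and> bichromatic c p"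
    then obtain p where p: "is_cycle E p" "bichromatic c p" by blast
    have "card (c ` cycle_edges p) = card (cycle_edges p)"
      using c(2) p(1) unfolding is_cycle_def by (intro card_image) (blast intro: inj_on_subset)
    then show False
      using p card_cycle_edges_ge_3[of p] unfolding is_cycle_def bichromatic_def by simp
  qed
  then have "\<exists>k c. acyclic_edge_coloring E {..<k::nat} c" by blast
  then show ?thesis
    unfolding acyclic_chromatic_index_def by (rule LeastI_ex)
qed

end

theory Submission
  imports Defs
begin

text \<open>Fix a set \<open>C\<close> of \<open>\<Delta> + 1\<close> colors and let \<open>E\<close> be a counterexample with fewest edges, so that
  \<open>E\<close> becomes colorable when any edge is removed. Call a neighbor big if its degree exceeds 2,
  and call a vertex light if it has at most two big neighbors. A light vertex \<open>q\<close> serves as a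
  pivot: one of the edges \<open>qx\<close> to its set \<open>X\<close> of neighbors of degree at most 2 is left
  uncolored, and only edges that meet \<open>X\<close> are recolored.

  Let \<open>y\<close> be the second neighbor of \<open>x\<close>. If \<open>qx\<close> cannot be colored, then for every color
  \<open>\<delta>\<close> free at \<open>q\<close> a bichromatic cycle \<open>x y \<dots> z q x\<close> would arise, where \<open>xy\<close> and
  \<open>qz\<close> have the same color. Its vertex \<open>z\<close> does not depend on \<open>\<delta>\<close> and sees all these
  \<open>\<delta>\<close>, so \<open>z\<close> is big. Since \<open>xy\<close> can be given at least two colors, \<open>q\<close> must have exactly
  two big neighbors \<open>z\<^sub>1\<close>, \<open>z\<^sub>2\<close>, and \<open>y\<close> sees, apart from \<open>xy\<close>, all colors but the
  colors \<open>a\<close>, \<open>b\<close> of \<open>qz\<^sub>1\<close>, \<open>qz\<^sub>2\<close> (\<open>stuck_if_unextendable\<close>). A bichromatic path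
  starting with \<open>qz\<^sub>1\<close> has only one other end, so two edges \<open>qx\<close>, \<open>qx'\<close> are never stuck
  simultaneously (\<open>not_two_stuck\<close>). This gives the freedom to rearrange the colors on the edges
  from \<open>q\<close> to \<open>X\<close>, and hence such a path exists for every \<open>\<delta>\<close> other than \<open>a\<close>, \<open>b\<close>
  and not just for the free ones (\<open>stuck_all_colors\<close>). Consequently \<open>z\<^sub>1\<close> has degree \<open>\<Delta>\<close>
  and sees all colors but \<open>b\<close>, every neighbor of \<open>z\<^sub>1\<close> other than \<open>q\<close> has a further edge
  colored \<open>a\<close> (\<open>saturated\<close>), and symmetrically for \<open>z\<^sub>2\<close>; in particular \<open>a\<close> and \<open>b\<close> may
  be exchanged on \<open>qz\<^sub>1\<close> and \<open>qz\<^sub>2\<close> (\<open>swap_outer_colors\<close>).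

  Degeneracy, applied to the vertices of degree above 2 and then to those among them which are
  not light, yields a vertex \<open>p\<close> that is a big neighbor of two light vertices \<open>q\<close> and \<open>w\<close>
  (\<open>two_pivots\<close>). Let \<open>qz\<close> and \<open>wr\<close> be the other edges from \<open>q\<close> and \<open>w\<close> to big
  neighbors. If \<open>p\<close> sees both the color of \<open>qz\<close> and that of \<open>wr\<close>, then by saturation neither
  the edges at \<open>q\<close> nor those at \<open>w\<close> can get stuck and \<open>E\<close> is colorable. The rules above force
  \<open>qz\<close> and \<open>wr\<close> to share the color \<open>b\<close> that \<open>p\<close> misses, and then \<open>pq\<close>, \<open>qz\<close>,
  \<open>pw\<close>, \<open>wr\<close> can be recolored \<open>b\<close>, \<open>a\<close>, \<open>a\<close>, \<open>b\<close>; when \<open>qz\<close> and \<open>wr\<close> are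
  the same edge, it suffices to give this edge another color that \<open>p\<close> sees
  (\<open>no_minimal_counterexample\<close>).\<close>

section \<open>Leafless edge sets\<close>

text \<open>Leafless edge sets take the place of cycles: they need no list of vertices, and the critical
  cycles below can be compared by counting degrees. The edges of a cycle form a leafless set, and
  a finite nonempty leafless set contains a cycle, so \<open>good\<close> describes the acyclic edge colorings.\<close>

definition leafless :: "'a set set \<Rightarrow> bool" where
  "leafless F \<longleftrightarrow> (\<forall>e\<in>F. \<forall>v\<in>e. \<exists>f\<in>F. f \<noteq> e \<and> v \<in> f)"

lemma leaflessE:
  assumes "leafless F" "e \<in> F" "v \<in> e"
  obtains f where "f \<in> F" "f \<noteq> e" "v \<in> f"
  using assms unfolding leafless_def by blast

definition good :: "'a set set \<Rightarrow> 'c set \<Rightarrow> ('a set \<Rightarrow> 'c) \<Rightarrow> bool" where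
  "good E C c \<longleftrightarrow> proper_edge_coloring E C c \<and>
     (\<forall>F \<alpha> \<beta>. F \<subseteq> E \<and> leafless F \<and> c ` F \<subseteq> {\<alpha>, \<beta>} \<longrightarrow> F = {})"

lemma leafless_cycle_edges:
  assumes "3 \<le> length p" "distinct p"
  shows "leafless (cycle_edges p)"
  unfolding leafless_def
proof (intro ballI)
  let ?n = "length p"
  let ?s = "\<lambda>i. Suc i mod ?n"
  fix e v assume e: "e \<in> cycle_edges p" and v: "v \<in> e"
  obtain i where i: "i < ?n" "e = {p ! i, p ! ?s i}"
    using e unfolding cycle_edges_def by blast
  have eq: "p ! k = p ! l \<longleftrightarrow> k = l" if "k < ?n" "l < ?n" for k l
    using that assms(2) by (rule nth_eq_iff_index_eq[rotated])
  have mem: "{p ! k, p ! ?s k} \<in> cycle_edges p" if "k < ?n" for k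
    using that unfolding cycle_edges_def by blast
  have sn: "?s k < ?n" for k
    using assms(1) by (intro mod_less_divisor) linarith
  have s: "?s k = (if Suc k = ?n then 0 else Suc k)" if "k < ?n" for k
    using that by auto
  have ss: "?s k \<noteq> k" "?s (?s k) \<noteq> k" if "k < ?n" for k
    using s[OF that] s[OF sn[of k]] that assms(1) by (auto split: if_splits)
  consider "v = p ! i" | "v = p ! ?s i" using v i by auto
  then show "\<exists>f\<in>cycle_edges p. f \<noteq> e \<and> v \<in> f"
  proof cases
    case 1
    define j where "j = (if i = 0 then ?n - 1 else i - 1)"
    have j: "j < ?n" "?s j = i"
      using i(1) assms(1) by (auto simp: j_def)
    have "{p ! j, p ! ?s j} \<noteq> e"
      using ss[OF j(1)] j i eq sn by (auto simp: doubleton_eq_iff)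
    then show ?thesis using mem[OF j(1)] 1 j by auto
  next
    case 2
    have "{p ! ?s i, p ! ?s (?s i)} \<noteq> e"
      using ss[OF i(1)] ss[OF sn[of i]] i eq sn by (auto simp: doubleton_eq_iff)
    then show ?thesis using mem[OF sn[of i]] 2 by auto
  qed
qed

lemma good_imp_acyclic:
  assumes "good E C c"
  shows "acyclic_edge_coloring E C c"
  unfolding acyclic_edge_coloring_def
proof (intro conjI notI)
  show "proper_edge_coloring E C c" using assms unfolding good_def by blast
next
  assume "\<exists>p. is_cycle E p \<and> bichromatic c p"
  then obtain p where p: "3 \<le> length p" "distinct p" "cycle_edges p \<subseteq> E"
    and b: "card (c ` cycle_edges p) \<le> 2"
    unfolding is_cycle_def bichromatic_def by blast
  have ne: "cycle_edges p \<noteq> {}"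
    using card_cycle_edges_ge_3[OF p(1,2)] by auto
  have fin: "finite (c ` cycle_edges p)" by (simp add: finite_cycle_edges)
  have "\<exists>\<alpha> \<beta>. c ` cycle_edges p \<subseteq> {\<alpha>, \<beta>}"
  proof -
    have "card (c ` cycle_edges p) \<noteq> 0" using ne fin by simp
    then consider "card (c ` cycle_edges p) = 1" | "card (c ` cycle_edges p) = 2"
      using b by linarith
    then show ?thesis
    proof cases
      case 1
      then show ?thesis by (auto simp: card_1_singleton_iff)
    next
      case 2
      then show ?thesis unfolding card_2_iff by blast
    qed
  qed
  then show False
    using assms leafless_cycle_edges[OF p(1,2)] p(3) ne unfolding good_def by blast
qed

text \<open>Leaflessness demands a second edge at \<open>v\<close>, and two colors leave no room for a third.\<close>

lemma leafless_two_edges: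
  assumes "leafless F" "g ` F \<subseteq> {\<alpha>, \<beta>}"
    and "\<And>e f. e \<in> F \<Longrightarrow> f \<in> F \<Longrightarrow> v \<in> e \<Longrightarrow> v \<in> f \<Longrightarrow> e \<noteq> f \<Longrightarrow> g e \<noteq> g f"
    and "e \<in> F" "v \<in> e"
  obtains f where "f \<in> F" "v \<in> f" "f \<noteq> e" "{h \<in> F. v \<in> h} = {e, f}"
proof -
  obtain f where f: "f \<in> F" "v \<in> f" "f \<noteq> e"
    using assms(1,4,5) unfolding leafless_def by blast
  have "h = e \<or> h = f" if h: "h \<in> F" "v \<in> h" for h
  proof (rule ccontr)
    assume "\<not> (h = e \<or> h = f)"
    then have "g h \<noteq> g e" "g h \<noteq> g f" "g e \<noteq> g f"
      using assms(3-5) f h by blast+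
    then show False using assms(2) f h assms(4) by (metis image_subset_iff insert_iff singletonD)
  qed
  then show ?thesis using that[OF f] f assms(4,5) by blast
qed

lemma degree_handshake:
  assumes "finite F" "\<And>e. e \<in> F \<Longrightarrow> card e = 2"
    and "\<And>v. v \<noteq> q \<Longrightarrow> even (degree F v)"
  shows "even (degree F q)"
proof -
  let ?V = "insert q (\<Union>F)"
  have fV: "finite ?V"
    using assms(1,2) by (metis card.infinite finite.insertI finite_Union zero_neq_numeral)
  have "(\<Sum>v\<in>?V. degree F v) = (\<Sum>v\<in>?V. \<Sum>e\<in>F. if v \<in> e then 1 else 0)"
    unfolding degree_def using assms(1) by (simp add: sum.If_cases Int_def)
  also have "\<dots> = (\<Sum>e\<in>F. \<Sum>v\<in>?V. if v \<in> e then 1 else 0)"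
    by (rule sum.swap)
  also have "\<dots> = (\<Sum>e\<in>F. 2)"
  proof (rule sum.cong[OF refl])
    fix e assume e: "e \<in> F"
    then have "?V \<inter> e = e" by blast
    then show "(\<Sum>v\<in>?V. if v \<in> e then 1 else 0) = (2::nat)"
      using fV assms(2)[OF e] by (simp add: sum.If_cases Int_def[symmetric] del: insert_iff)
  qed
  finally have "even (\<Sum>v\<in>?V. degree F v)" by simp
  moreover have "(\<Sum>v\<in>?V. degree F v) = degree F q + (\<Sum>v\<in>?V - {q}. degree F v)"
    using fV by (intro sum.remove) auto
  moreover have "even (\<Sum>v\<in>?V - {q}. degree F v)"
    using assms(3) by (intro dvd_sum) auto
  ultimately show ?thesis by simp
qed

text \<open>Two cycles in the same two colors agree at every common vertex where the coloring is proper.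
  Hence following \<open>F\<close> and \<open>F'\<close> from \<open>q\<close> along the shared edge \<open>s\<close> leads to the same end,
  and they cannot return to \<open>q\<close> by different edges. The formal argument is a parity count: in
  \<open>F - F'\<close> the vertex \<open>q\<close> would be the only one of odd degree.\<close>

lemma leafless_share_edge:
  assumes F: "finite F" "\<And>e. e \<in> F \<Longrightarrow> card e = 2" "leafless F" "g ` F \<subseteq> {\<alpha>, \<beta>}"
    and F': "leafless F'" "g ` F' \<subseteq> {\<alpha>, \<beta>}"
    and pr: "\<And>v e f. v \<noteq> q \<Longrightarrow> e \<in> F \<union> F' \<Longrightarrow> f \<in> F \<union> F' \<Longrightarrow> v \<in> e \<Longrightarrow> v \<in> f
      \<Longrightarrow> e \<noteq> f \<Longrightarrow> g e \<noteq> g f"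
    and q: "{h \<in> F. q \<in> h} = {s, t}" "s \<in> F'" "t \<notin> F'"
  shows False
proof -
  let ?D = "F - F'"
  have "{h \<in> ?D. q \<in> h} = {h \<in> F. q \<in> h} - F'" by blast
  also have "\<dots> = {t}" unfolding q(1) using q(2,3) by auto
  finally have "{h \<in> ?D. q \<in> h} = {t}" .
  then have "odd (degree ?D q)" unfolding degree_def by simp
  moreover have "even (degree ?D v)" if v: "v \<noteq> q" for v
  proof (cases "\<exists>e\<in>F'. v \<in> e")
    case True
    then obtain e where e: "e \<in> F'" "v \<in> e" by blast
    obtain f where f: "f \<in> F'" "v \<in> f" "f \<noteq> e"
      using F'(1) e unfolding leafless_def by blast
    have "h \<in> F'" if h: "h \<in> F" "v \<in> h" for h
    proof (rule ccontr)
      assume n: "h \<notin> F'"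
      have "g h \<noteq> g e" "g h \<noteq> g f" "g e \<noteq> g f"
        using pr[OF v] e f h n by blast+
      then show False
        using F(4) F'(2) e f h by (metis image_subset_iff insert_iff singletonD)
    qed
    then have "{h \<in> ?D. v \<in> h} = {}" by blast
    then show ?thesis unfolding degree_def by (metis card.empty even_zero)
  next
    case False
    then have eq: "{h \<in> ?D. v \<in> h} = {h \<in> F. v \<in> h}" by blast
    show ?thesis
    proof (cases "\<exists>e\<in>F. v \<in> e")
      case True
      then obtain e where e: "e \<in> F" "v \<in> e" by blast
      obtain f where "f \<in> F" "v \<in> f" "f \<noteq> e" "{h \<in> F. v \<in> h} = {e, f}"
        by (rule leafless_two_edges[OF F(3,4) _ e]) (use pr[OF v] in blast)+
      then show ?thesis unfolding degree_def eq by simp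
    next
      case False
      then have "{h \<in> F. v \<in> h} = {}" by blast
      then show ?thesis unfolding degree_def eq by (metis card.empty even_zero)
    qed
  qed
  ultimately show False
    using degree_handshake[of ?D q] F(1,2) by blast
qed

lemma good_subset: "good E C c \<Longrightarrow> E' \<subseteq> E \<Longrightarrow> good E' C c"
  unfolding good_def proper_edge_coloring_def by (meson image_mono subset_iff order_trans)

lemma proper_inj:
  assumes "proper_edge_coloring E C c" "e \<in> E" "f \<in> E" "v \<in> e" "v \<in> f" "c e = c f"
  shows "e = f"
proof (rule ccontr)
  assume "e \<noteq> f"
  moreover have "e \<inter> f \<noteq> {}" using assms(4,5) by blast
  ultimately show False using assms(1-3,6) unfolding proper_edge_coloring_def by simp
qed

section \<open>Coloring one more edge\<close>

definition free_colors :: "'a set set \<Rightarrow> 'c set \<Rightarrow> ('a set \<Rightarrow> 'c) \<Rightarrow> 'a \<Rightarrow> 'c set" where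
  "free_colors E C c v = C - c ` {e \<in> E. v \<in> e}"

text \<open>\<open>F\<close> stands for the bichromatic cycle \<open>x y \<dots> z q x\<close> that appears when \<open>xy\<close> receives the
  color of \<open>qz\<close> and \<open>qx\<close> receives \<open>\<delta>\<close>. Without \<open>qx\<close> it is a bichromatic path from
  \<open>q\<close> through \<open>z\<close> to \<open>x\<close>.\<close>

definition critical ::
    "'a set set \<Rightarrow> ('a set \<Rightarrow> 'c) \<Rightarrow> 'a \<Rightarrow> 'a \<Rightarrow> 'a \<Rightarrow> 'a \<Rightarrow> 'c \<Rightarrow> 'a set set \<Rightarrow> bool" where
  "critical E c q x y z \<delta> F \<longleftrightarrow> F \<subseteq> E \<and> leafless F \<and> {q, x} \<in> F \<and> {x, y} \<in> F \<and> {q, z} \<in> F \<and>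
     (c({x, y} := c {q, z}, {q, x} := \<delta>)) ` F \<subseteq> {c {q, z}, \<delta>}"

lemma two_element_edge:
  assumes "card e = 2" "v \<in> e"
  obtains w where "e = {v, w}" "w \<noteq> v"
  using assms unfolding card_2_iff by blast

lemma good_proper: "good E C c \<Longrightarrow> proper_edge_coloring E C c"
  unfolding good_def by blast

lemma proper_color_edge:
  assumes p: "proper_edge_coloring (E - {{q, x}}) C c"
    and \<delta>: "\<delta> \<in> free_colors (E - {{q, x}}) C c q"
    and x: "\<And>e. e \<in> E \<Longrightarrow> x \<in> e \<Longrightarrow> e \<noteq> {q, x} \<Longrightarrow> c e \<noteq> \<delta>"
  shows "proper_edge_coloring E C (c({q, x} := \<delta>))"
proof -
  have "c e \<noteq> \<delta>" if "e \<in> E" "e \<noteq> {q, x}" "e \<inter> {q, x} \<noteq> {}" for e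
    using that x \<delta> unfolding free_colors_def by blast
  moreover have "\<delta> \<in> C" using \<delta> unfolding free_colors_def by blast
  ultimately show ?thesis
    using p unfolding proper_edge_coloring_def
    by (auto simp: Int_commute image_subset_iff)
qed

lemma color_edge:
  assumes g: "good (E - {{q, x}}) C c"
    and \<delta>: "\<delta> \<in> free_colors (E - {{q, x}}) C c q"
    and x: "\<And>e. e \<in> E \<Longrightarrow> x \<in> e \<Longrightarrow> e \<noteq> {q, x} \<Longrightarrow> c e \<noteq> \<delta>"
    and ng: "\<not> good E C (c({q, x} := \<delta>))"
  obtains F \<alpha> \<beta> where "F \<subseteq> E" "leafless F" "{q, x} \<in> F" "(c({q, x} := \<delta>)) ` F \<subseteq> {\<alpha>, \<beta>}"
proof -
  let ?c = "c({q, x} := \<delta>)"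
  have "proper_edge_coloring E C ?c"
    using proper_color_edge[OF good_proper[OF g] \<delta> x] by blast
  then obtain F \<alpha> \<beta> where F: "F \<subseteq> E" "leafless F" "?c ` F \<subseteq> {\<alpha>, \<beta>}" "F \<noteq> {}"
    using ng unfolding good_def by blast
  have "{q, x} \<in> F"
  proof (rule ccontr)
    assume n: "{q, x} \<notin> F"
    then have "c ` F = ?c ` F" by (intro image_cong) auto
    then show False using g F n unfolding good_def by (metis subset_Diff_insert Diff_empty)
  qed
  then show ?thesis using that F by blast
qed

text \<open>A pendant edge lies on no cycle, so any color not seen at its inner end will do.\<close>

lemma recolor_pendant_edge:
  assumes g: "good A C c" and \<epsilon>: "\<epsilon> \<in> C"
    and x: "\<And>e. e \<in> A \<Longrightarrow> x \<in> e \<Longrightarrow> e = {x, y}"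
    and y: "\<And>e. e \<in> A \<Longrightarrow> y \<in> e \<Longrightarrow> e \<noteq> {x, y} \<Longrightarrow> c e \<noteq> \<epsilon>"
  shows "good A C (c({x, y} := \<epsilon>))"
  unfolding good_def
proof (intro conjI allI impI)
  have "c e \<noteq> \<epsilon>" if "e \<in> A" "e \<noteq> {x, y}" "e \<inter> {x, y} \<noteq> {}" for e
    using that x y by blast
  then show "proper_edge_coloring A C (c({x, y} := \<epsilon>))"
    using good_proper[OF g] \<epsilon> unfolding proper_edge_coloring_def
    by (auto simp: Int_commute image_subset_iff)
next
  fix F \<alpha> \<beta> assume F: "F \<subseteq> A \<and> leafless F \<and> (c({x, y} := \<epsilon>)) ` F \<subseteq> {\<alpha>, \<beta>}"
  have "{x, y} \<notin> F"
  proof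
    assume "{x, y} \<in> F"
    then obtain f where "f \<in> F" "f \<noteq> {x, y}" "x \<in> f"
      using F leaflessE[of F "{x, y}" x] by auto
    then show False using F x by auto
  qed
  then have "c ` F = (c({x, y} := \<epsilon>)) ` F" by (intro image_cong) auto
  then show "F = {}" using F g unfolding good_def by metis
qed

lemma card_free_colors:
  assumes "finite E" "finite C" "degree E v \<le> d" "d + k \<le> card C"
  shows "k \<le> card (free_colors E C c v)"
proof -
  have fin: "finite {e \<in> E. v \<in> e}" using assms(1) by simp
  have "card (c ` {e \<in> E. v \<in> e}) \<le> d"
    using card_image_le[OF fin, of c] assms(3) unfolding degree_def by linarith
  then show ?thesis
    unfolding free_colors_def
    using diff_card_le_card_Diff[of "c ` {e \<in> E. v \<in> e}" C] fin assms(4) by fastforce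
qed

lemma degree_remove_edge:
  assumes "finite E" "e \<in> E" "v \<in> e"
  shows "degree E v = Suc (degree (E - {e}) v)"
proof -
  have "{f \<in> E. v \<in> f} = insert e {f \<in> E - {e}. v \<in> f}" using assms by blast
  then show ?thesis unfolding degree_def using assms(1) by simp
qed

text \<open>The local reason why an edge \<open>qx\<close> with \<open>x\<close> of degree at most 2 cannot be colored. While
  \<open>qx\<close> is missing, \<open>xy\<close> is pendant and may take any color \<open>\<epsilon>\<close> that \<open>y\<close> does not see
  elsewhere. For a color \<open>\<delta>\<close> free at \<open>q\<close> the resulting cycle leaves \<open>q\<close> by an edge colored
  \<open>\<epsilon>\<close>, because \<open>\<delta>\<close> is not available there; this edge \<open>qz\<close> is the same for all \<open>\<delta>\<close>.\<close>

lemma blocked_edge: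
  assumes E: "finite E" "\<And>e. e \<in> E \<Longrightarrow> card e = 2" and C: "finite C"
    and deg: "\<And>v. degree E v < card C" and degx: "degree E x \<le> 2"
    and qx: "{q, x} \<in> E" and g: "good (E - {{q, x}}) C c"
    and unext: "\<And>c'. (\<And>e. x \<notin> e \<Longrightarrow> c' e = c e) \<Longrightarrow> \<not> good E C c'"
  shows "\<exists>y. {x, y} \<in> E \<and> y \<noteq> q \<and> (\<forall>e\<in>E. x \<in> e \<longrightarrow> e = {q, x} \<or> e = {x, y}) \<and>
    (\<forall>\<epsilon>\<in>C - c ` {e \<in> E. y \<in> e \<and> e \<noteq> {x, y}}.
       \<exists>z. z \<noteq> x \<and> {q, z} \<in> E \<and> c {q, z} = \<epsilon> \<and>
         (\<forall>\<delta>\<in>free_colors (E - {{q, x}}) C c q. \<exists>F. critical E c q x y z \<delta> F))"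
proof -
  let ?A = "E - {{q, x}}"
  let ?M = "free_colors ?A C c q"
  have qnx: "q \<noteq> x" using E(2)[OF qx] by auto
  have "degree ?A q + 2 \<le> card C"
    using deg[of q] degree_remove_edge[OF E(1) qx, of q] by simp
  then have M: "2 \<le> card ?M"
    using card_free_colors[of ?A C q "degree ?A q" 2 c] E(1) C by simp
  have other: "\<exists>\<delta>\<in>?M. \<delta> \<noteq> \<epsilon>" for \<epsilon>
  proof (rule ccontr)
    assume "\<not> ?thesis"
    then have "?M \<subseteq> {\<epsilon>}" by blast
    then have "card ?M \<le> card {\<epsilon>}" by (intro card_mono) auto
    then show False using M by simp
  qed
  have "\<exists>e\<in>E. x \<in> e \<and> e \<noteq> {q, x}"
  proof (rule ccontr)
    assume n: "\<not> ?thesis"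
    obtain \<delta> where \<delta>: "\<delta> \<in> ?M" using other by blast
    have ng: "\<not> good E C (c({q, x} := \<delta>))" by (rule unext) auto
    obtain F \<alpha> \<beta> where F: "F \<subseteq> E" "leafless F" "{q, x} \<in> F" "(c({q, x} := \<delta>)) ` F \<subseteq> {\<alpha>, \<beta>}"
      by (rule color_edge[OF g \<delta> _ ng]) (use n in auto)
    obtain f where "f \<in> F" "f \<noteq> {q, x}" "x \<in> f"
      by (rule leaflessE[OF F(2,3), of x]) auto
    then show False using n F(1) by auto
  qed
  then obtain y where y: "{x, y} \<in> E" "{x, y} \<noteq> {q, x}"
    by (metis E(2) two_element_edge)
  have xe: "e = {q, x} \<or> e = {x, y}" if e: "e \<in> E" "x \<in> e" for e
  proof (rule ccontr)
    assume "\<not> ?thesis"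
    then have "card {e, {q, x}, {x, y}} = 3" using y(2) by auto
    moreover have "card {e, {q, x}, {x, y}} \<le> degree E x"
      unfolding degree_def using e qx y E(1) by (intro card_mono) auto
    ultimately show False using degx by simp
  qed
  have ynq: "y \<noteq> q" using y(2) by auto
  have main: "\<exists>z F. z \<noteq> x \<and> {q, z} \<in> E \<and> c {q, z} = \<epsilon> \<and> critical E c q x y z \<delta> F"
    if \<epsilon>: "\<epsilon> \<in> C - c ` {e \<in> E. y \<in> e \<and> e \<noteq> {x, y}}" and \<delta>: "\<delta> \<in> ?M" "\<delta> \<noteq> \<epsilon>" for \<epsilon> \<delta>
  proof -
    let ?c1 = "c({x, y} := \<epsilon>)"
    let ?c2 = "?c1({q, x} := \<delta>)"
    have g1: "good ?A C ?c1"
      by (rule recolor_pendant_edge[OF g]) (use \<epsilon> xe in auto)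
    have \<delta>1: "\<delta> \<in> free_colors ?A C ?c1 q"
      using \<delta>(1) qnx ynq unfolding free_colors_def by (auto simp: image_iff)
    have ng: "\<not> good E C ?c2" by (rule unext) auto
    obtain F \<alpha> \<beta> where F: "F \<subseteq> E" "leafless F" "{q, x} \<in> F" "?c2 ` F \<subseteq> {\<alpha>, \<beta>}"
      by (rule color_edge[OF g1 \<delta>1 _ ng]) (use xe \<delta>(2) in auto)
    obtain h where h: "h \<in> F" "h \<noteq> {q, x}" "x \<in> h"
      by (rule leaflessE[OF F(2,3), of x]) auto
    then have xyF: "{x, y} \<in> F"
      using F(1) xe[of h] by auto
    obtain f where f: "f \<in> F" "f \<noteq> {q, x}" "q \<in> f"
      by (rule leaflessE[OF F(2,3), of q]) auto
    obtain z where z: "f = {q, z}" "z \<noteq> q" using f F(1) E(2) by (meson subsetD two_element_edge)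
    have fE: "f \<in> E" using f F(1) by blast
    have fxy: "f \<noteq> {x, y}" using f(3) qnx ynq by blast
    have c2: "?c2 {q, x} = \<delta>" "?c2 {x, y} = \<epsilon>" "?c2 f = c f" using y(2) f(2) fxy by auto
    have sub: "?c2 ` F \<subseteq> {\<epsilon>, \<delta>}"
      using F(4) c2(1,2) F(3) xyF \<delta>(2) by (smt (verit) image_subset_iff insert_iff singletonD)
    have "c f \<noteq> \<delta>" using \<delta>(1) f fE unfolding free_colors_def by blast
    then have cf: "c {q, z} = \<epsilon>" using sub f(1) c2(3) z(1) by (metis image_subset_iff insert_iff singletonD)
    have "critical E c q x y z \<delta> F"
      unfolding critical_def cf using F xyF f(1) z(1) sub by blast
    moreover have "z \<noteq> x" using f(2) z(1) by blast
    ultimately show ?thesis using cf fE z(1) by blast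
  qed
  have all: "\<exists>z. z \<noteq> x \<and> {q, z} \<in> E \<and> c {q, z} = \<epsilon> \<and>
         (\<forall>\<delta>\<in>?M. \<exists>F. critical E c q x y z \<delta> F)"
    if \<epsilon>: "\<epsilon> \<in> C - c ` {e \<in> E. y \<in> e \<and> e \<noteq> {x, y}}" for \<epsilon>
  proof -
    obtain z where z: "z \<noteq> x" "{q, z} \<in> E" "c {q, z} = \<epsilon>"
      using other[of \<epsilon>] main[OF \<epsilon>] by blast
    have zA: "{q, z} \<in> ?A" using z(1,2) by (auto simp: doubleton_eq_iff)
    have "\<exists>F. critical E c q x y z \<delta> F" if \<delta>: "\<delta> \<in> ?M" for \<delta>
    proof -
      have "\<delta> \<noteq> \<epsilon>" using \<delta> zA z(3) unfolding free_colors_def by blast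
      then obtain z' F where z': "z' \<noteq> x" "{q, z'} \<in> E" "c {q, z'} = \<epsilon>" "critical E c q x y z' \<delta> F"
        using main[OF \<epsilon> \<delta>] by blast
      have "{q, z'} \<in> ?A" using z'(1,2) by (auto simp: doubleton_eq_iff)
      then have "{q, z'} = {q, z}"
        using proper_inj[OF good_proper[OF g] _ zA, of "{q, z'}" q] z(3) z'(3) by blast
      then have "z' = z" by (auto simp: doubleton_eq_iff)
      then show ?thesis using z'(4) by blast
    qed
    then show ?thesis using z by blast
  qed
  show ?thesis
  proof (rule exI[of _ y], intro conjI)
    show "\<forall>e\<in>E. x \<in> e \<longrightarrow> e = {q, x} \<or> e = {x, y}" using xe by simp
  qed (use y(1) ynq all in simp_all)
qed

section \<open>Stuck edges\<close>

text \<open>What non-extendability forces at a pivot \<open>q\<close> with set \<open>R\<close> of big neighbors: \<open>y\<close> is the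
  second neighbor of \<open>x\<close>, and it misses, apart from \<open>xy\<close>, exactly the colors of the edges
  from \<open>q\<close> to \<open>R\<close>.\<close>

definition stuck ::
    "'a set set \<Rightarrow> 'c set \<Rightarrow> ('a set \<Rightarrow> 'c) \<Rightarrow> 'a \<Rightarrow> 'a \<Rightarrow> 'a \<Rightarrow> 'a set \<Rightarrow> bool" where
  "stuck E C c q x y R \<longleftrightarrow> {x, y} \<in> E \<and> y \<noteq> q \<and> (\<forall>e\<in>E. x \<in> e \<longrightarrow> e = {q, x} \<or> e = {x, y}) \<and>
     card R = 2 \<and> (\<forall>z\<in>R. z \<noteq> x \<and> {q, z} \<in> E) \<and>
     c ` {e \<in> E. y \<in> e \<and> e \<noteq> {x, y}} = C - (\<lambda>z. c {q, z}) ` R \<and>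
     (\<forall>z\<in>R. \<forall>\<delta>\<in>free_colors (E - {{q, x}}) C c q. \<exists>F. critical E c q x y z \<delta> F)"

lemma criticalD:
  assumes "critical E c q x y z \<delta> F"
  shows "F \<subseteq> E" "leafless F" "{q, x} \<in> F" "{x, y} \<in> F" "{q, z} \<in> F"
    "\<And>e. e \<in> F \<Longrightarrow> (c({x, y} := c {q, z}, {q, x} := \<delta>)) e \<in> {c {q, z}, \<delta>}"
  using assms unfolding critical_def by (elim conjE; simp add: image_subset_iff del: fun_upd_apply)+

lemma stuckD:
  assumes "stuck E C c q x y R"
  shows "{x, y} \<in> E" "y \<noteq> q" "\<And>e. e \<in> E \<Longrightarrow> x \<in> e \<Longrightarrow> e = {q, x} \<or> e = {x, y}" "card R = 2"
    "\<And>z. z \<in> R \<Longrightarrow> z \<noteq> x" "\<And>z. z \<in> R \<Longrightarrow> {q, z} \<in> E"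
    "c ` {e \<in> E. y \<in> e \<and> e \<noteq> {x, y}} = C - (\<lambda>z. c {q, z}) ` R"
    "\<And>z \<delta>. z \<in> R \<Longrightarrow> \<delta> \<in> free_colors (E - {{q, x}}) C c q \<Longrightarrow> \<exists>F. critical E c q x y z \<delta> F"
  using assms unfolding stuck_def by (elim conjE; simp)+

lemma critical_at_pivot:
  assumes p: "proper_edge_coloring (E - {{q, x}}) C c" and F: "critical E c q x y z \<delta> F"
    and \<delta>: "\<delta> \<in> free_colors (E - {{q, x}}) C c q" and ne: "z \<noteq> x" "q \<noteq> x" "y \<noteq> q"
  shows "{h \<in> F. q \<in> h} = {{q, z}, {q, x}}"
proof -
  have "h = {q, z}" if h: "h \<in> F" "q \<in> h" "h \<noteq> {q, x}" for h
  proof -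
    have hE: "h \<in> E - {{q, x}}" using h criticalD(1)[OF F] by blast
    have zE: "{q, z} \<in> E - {{q, x}}" using criticalD(1,5)[OF F] ne by (auto simp: doubleton_eq_iff)
    have "h \<noteq> {x, y}" using h(2) ne by auto
    then have "(c({x, y} := c {q, z}, {q, x} := \<delta>)) h = c h" using h(3) by simp
    then have "c h = c {q, z} \<or> c h = \<delta>" using criticalD(6)[OF F h(1)] by simp
    moreover have "c h \<noteq> \<delta>" using \<delta> hE h(2) unfolding free_colors_def by blast
    ultimately show ?thesis using proper_inj[OF p hE zE h(2)] by simp
  qed
  then show ?thesis using criticalD(3,5)[OF F] by blast
qed

text \<open>A critical cycle through \<open>qx\<close> and \<open>qz\<close> could pass a second neighbor \<open>x'\<close> of \<open>q\<close> of degree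
  at most 2 only by using \<open>qx'\<close>, but it has no third edge at \<open>q\<close>.\<close>

lemma critical_avoids:
  assumes p: "proper_edge_coloring (E - {{q, x}}) C c" and F: "critical E c q x y z \<delta> F"
    and \<delta>: "\<delta> \<in> free_colors (E - {{q, x}}) C c q" and ne: "z \<noteq> x" "q \<noteq> x" "y \<noteq> q"
    and x': "x' \<noteq> x" "x' \<noteq> z" "x' \<noteq> q"
    and e': "\<And>e. e \<in> E \<Longrightarrow> x' \<in> e \<Longrightarrow> e = {q, x'} \<or> e = {x', y'}"
    and e: "e \<in> F"
  shows "x' \<notin> e"
proof
  assume "x' \<in> e"
  note l = criticalD(2,1)[OF F]
  obtain f where f: "f \<in> F" "f \<noteq> e" "x' \<in> f" by (rule leaflessE[OF l(1) e \<open>x' \<in> e\<close>])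
  have "{q, x'} \<in> F" using e'[of e] e'[of f] e f \<open>x' \<in> e\<close> l(2) by auto
  then have "{q, x'} \<in> {h \<in> F. q \<in> h}" by simp
  then show False
    unfolding critical_at_pivot[OF p F \<delta> ne] using x' by (auto simp: doubleton_eq_iff)
qed

text \<open>If \<open>y = y'\<close>, then the color of \<open>x'y\<close> is seen from \<open>x\<close> and thus differs from the two colors
  missing at \<open>y\<close>; seen from \<open>x'\<close> it must then occur at \<open>y\<close> on yet another edge.\<close>

lemma two_stuck_neighbors:
  assumes card2: "\<And>e. e \<in> E1 \<union> E2 \<Longrightarrow> card e = 2"
    and p: "proper_edge_coloring (E1 - {{q, x}}) C c" "proper_edge_coloring (E2 - {{q, x'}}) C c'"
    and s: "stuck E1 C c q x y R" and s': "stuck E2 C c' q x' y' R"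
    and xx': "x \<noteq> x'" and qx: "{q, x} \<in> E1" "{q, x'} \<in> E2"
    and EE: "E1 - {{q, x}, {q, x'}} = E2 - {{q, x}, {q, x'}}"
    and agree: "\<And>e. x \<notin> e \<Longrightarrow> c' e = c e"
  shows "y \<noteq> y'"
proof
  assume yy: "y = y'"
  have qn: "q \<noteq> x" "q \<noteq> x'" using card2[of "{q, x}"] card2[of "{q, x'}"] qx by auto
  have y: "y \<noteq> q" "{x, y} \<in> E1" and xy2: "{x', y} \<in> E2" using stuckD(1,2)[OF s] stuckD(1)[OF s'] yy by auto
  have yn: "y \<noteq> x" "y \<noteq> x'" using card2[of "{x, y}"] card2[of "{x', y}"] y xy2 by auto
  have R: "\<forall>z\<in>R. z \<noteq> x \<and> z \<noteq> x'" using stuckD(5)[OF s] stuckD(5)[OF s'] by blast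
  have img: "(\<lambda>z. c' {q, z}) ` R = (\<lambda>z. c {q, z}) ` R"
    using R qn by (intro image_cong) (auto intro!: agree)
  have "{x', y} \<in> E1" using xy2 EE yn y(1) qn by (auto simp: doubleton_eq_iff)
  then have "c {x', y} \<in> c ` {e \<in> E1. y \<in> e \<and> e \<noteq> {x, y}}"
    using xx' yn by (auto simp: doubleton_eq_iff)
  also have "\<dots> = c' ` {e \<in> E2. y \<in> e \<and> e \<noteq> {x', y}}"
    using stuckD(7)[OF s] stuckD(7)[OF s'] yy img by simp
  finally obtain g where "c {x', y} = c' g" and "g \<in> {e \<in> E2. y \<in> e \<and> e \<noteq> {x', y}}"
    by (rule imageE)
  then have g: "g \<in> E2" "y \<in> g" "g \<noteq> {x', y}" "c' g = c {x', y}" by simp_all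
  have "c' g = c' {x', y}" using g(4) agree[of "{x', y}"] xx' yn by auto
  then have "g = {x', y}"
    using proper_inj[OF p(2), of g "{x', y}" y] g xy2 y(1) yn qn by (auto simp: doubleton_eq_iff)
  then show False using g(3) by simp
qed

text \<open>The critical cycles for \<open>x\<close> and \<open>x'\<close> in the colors of \<open>qz\<close> and \<open>\<delta>\<close> share the edge
  \<open>qz\<close> and leave \<open>q\<close> by the different edges \<open>qx\<close> and \<open>qx'\<close>, contrary to
  \<open>leafless_share_edge\<close>. The graphs \<open>E1\<close> and \<open>E2\<close> may differ in the edges \<open>qx\<close> and
  \<open>qx'\<close>, and the colorings in the edges at \<open>x\<close>, because the lemma is applied both to a single
  coloring that leaves \<open>qx\<close> and \<open>qx'\<close> uncolored and to two colorings of which each leaves out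
  one of them.\<close>

lemma not_two_stuck:
  assumes card2: "\<And>e. e \<in> E1 \<union> E2 \<Longrightarrow> card e = 2" and fin: "finite E1"
    and p: "proper_edge_coloring (E1 - {{q, x}}) C c" "proper_edge_coloring (E2 - {{q, x'}}) C c'"
    and s: "stuck E1 C c q x y R" and s': "stuck E2 C c' q x' y' R"
    and xx': "x \<noteq> x'" and qx: "{q, x} \<in> E1" "{q, x'} \<in> E2"
    and EE: "E1 - {{q, x}, {q, x'}} = E2 - {{q, x}, {q, x'}}"
    and agree: "\<And>e. x \<notin> e \<Longrightarrow> c' e = c e"
    and \<delta>: "\<delta> \<in> free_colors (E1 - {{q, x}}) C c q" "\<delta> \<in> free_colors (E2 - {{q, x'}}) C c' q"
  shows False
proof -
  have yy: "y \<noteq> y'" by (rule two_stuck_neighbors[OF card2 p s s' xx' qx EE agree])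
  have qn: "q \<noteq> x" "q \<noteq> x'" using card2[of "{q, x}"] card2[of "{q, x'}"] qx by auto
  note y = stuckD(2,1)[OF s] stuckD(2,1)[OF s']
  have yn: "y \<noteq> x" "y' \<noteq> x'" using card2[of "{x, y}"] card2[of "{x', y'}"] y by auto
  note xe = stuckD(3)[OF s] and xe' = stuckD(3)[OF s']
  have xE2: "e = {q, x} \<or> e = {x, y}" if "e \<in> E2" "x \<in> e" for e
  proof -
    have "e \<noteq> {q, x'}" using that(2) xx' qn by auto
    then show ?thesis using that xe[of e] EE by blast
  qed
  have xE1: "e = {q, x'} \<or> e = {x', y'}" if "e \<in> E1" "x' \<in> e" for e
  proof -
    have "e \<noteq> {q, x}" using that(2) xx' qn by auto
    then show ?thesis using that xe'[of e] EE by blast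
  qed
  have "R \<noteq> {}" using stuckD(4)[OF s] by auto
  then obtain z where z: "z \<in> R" by blast
  then have zn: "z \<noteq> x" "z \<noteq> x'" and qz: "{q, z} \<in> E1" "{q, z} \<in> E2"
    using stuckD(5,6)[OF s] stuckD(5,6)[OF s'] by auto
  define a where "a = c {q, z}"
  have a': "c' {q, z} = a" unfolding a_def using agree zn qn by auto
  have aY: "a \<notin> c ` {e \<in> E1. y \<in> e \<and> e \<noteq> {x, y}}"
    unfolding stuckD(7)[OF s] a_def using z by auto
  have aY': "a \<notin> c' ` {e \<in> E2. y' \<in> e \<and> e \<noteq> {x', y'}}"
    unfolding stuckD(7)[OF s'] a'[symmetric] using z by auto
  obtain F where F: "critical E1 c q x y z \<delta> F" using stuckD(8)[OF s z \<delta>(1)] by blast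
  obtain F' where F': "critical E2 c' q x' y' z \<delta> F'" using stuckD(8)[OF s' z \<delta>(2)] by blast
  have Fx': "x' \<notin> e" if "e \<in> F" for e
    by (rule critical_avoids[OF p(1) F \<delta>(1) zn(1) qn(1) y(1) xx'[symmetric] zn(2)[symmetric] qn(2)[symmetric] xE1 that])
  have F'x: "x \<notin> e" if "e \<in> F'" for e
    by (rule critical_avoids[OF p(2) F' \<delta>(2) zn(2) qn(2) y(3) xx' zn(1)[symmetric] qn(1)[symmetric] xE2 that])
  note FE = criticalD(1-5)[OF F] and Fc = criticalD(6)[OF F, folded a_def]
  note FE' = criticalD(1-5)[OF F'] and Fc' = criticalD(6)[OF F', unfolded a']
  have "a \<noteq> \<delta>" using \<delta>(1) qz(1) zn(1) unfolding free_colors_def a_def by (auto simp: doubleton_eq_iff)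
  have x'y: "x' \<noteq> y" and xy': "x \<noteq> y'" using Fx'[OF FE(4)] F'x[OF FE'(4)] by auto
  \<comment> \<open>One coloring for both critical cycles, proper except that \<open>qx\<close> and \<open>qx'\<close> have the same color.\<close>
  define g where "g = c({x, y} := a, {q, x} := \<delta>, {x', y'} := a, {q, x'} := \<delta>)"
  have g1: "g {x, y} = a" "g {q, x} = \<delta>" "g {x', y'} = a" "g {q, x'} = \<delta>"
    using xx' qn y yn x'y xy' yy unfolding g_def by (auto simp: doubleton_eq_iff)
  have gF: "g e = (c({x, y} := a, {q, x} := \<delta>)) e" if "e \<in> F" for e
    using Fx'[OF that] unfolding g_def by auto
  have gF': "g e = (c'({x', y'} := a, {q, x'} := \<delta>)) e" if "e \<in> F'" for e
    using F'x[OF that] agree[of e] unfolding g_def by auto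
  have gFs: "g ` F \<subseteq> {a, \<delta>}" using Fc gF by (metis image_subsetI)
  have gFs': "g ` F' \<subseteq> {a, \<delta>}" using Fc' gF' by (metis image_subsetI)
  let ?plain = "\<lambda>e. e \<in> E1 \<and> e \<in> E2 \<and> e \<noteq> {q, x} \<and> e \<noteq> {q, x'} \<and> x \<notin> e \<and> x' \<notin> e \<and> g e = c e \<and> c' e = c e"
  have kind: "e = {q, x} \<or> e = {x, y} \<or> e = {q, x'} \<or> e = {x', y'} \<or> ?plain e" if "e \<in> F \<union> F'" for e
  proof -
    have E12: "e \<in> E1 \<union> E2" using that FE(1) FE'(1) by blast
    show ?thesis
    proof (cases "x \<in> e \<or> x' \<in> e")
      case True
      then have "e = {q, x} \<or> e = {x, y} \<or> e = {q, x'} \<or> e = {x', y'}"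
        using E12 xe[of e] xe'[of e] xE1[of e] xE2[of e] by (metis UnE)
      then show ?thesis by metis
    next
      case False
      then have "e \<noteq> {q, x}" "e \<noteq> {q, x'}" by auto
      then have "e \<in> E1 \<and> e \<in> E2" using E12 EE by blast
      moreover have "g e = c e" using False unfolding g_def by auto
      ultimately show ?thesis using False agree[of e] by blast
    qed
  qed
  have special: "g e \<noteq> g f"
    if v: "v \<noteq> q" "v \<in> e" "v \<in> f" "e \<noteq> f" and e: "e = {q, x} \<or> e = {x, y} \<or> e = {q, x'} \<or> e = {x', y'}"
      and f: "f \<in> F \<union> F'" for v e f
  proof -
    have pl: "c f \<noteq> a" if "?plain f" "(e = {x, y} \<or> e = {x', y'})"
    proof -
      have "y \<in> f \<and> e = {x, y} \<or> y' \<in> f \<and> e = {x', y'}" using that v by auto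
      then have "f \<in> {e \<in> E1. y \<in> e \<and> e \<noteq> {x, y}} \<or> f \<in> {e \<in> E2. y' \<in> e \<and> e \<noteq> {x', y'}}"
        using that(1) v(4) by blast
      then have "c f \<in> c ` {e \<in> E1. y \<in> e \<and> e \<noteq> {x, y}} \<or> c' f \<in> c' ` {e \<in> E2. y' \<in> e \<and> e \<noteq> {x', y'}}"
        by blast
      moreover have "c' f = c f" using that(1) by blast
      ultimately show ?thesis using aY aY' by metis
    qed
    have pl2: "\<not> ?plain f" if "e = {q, x} \<or> e = {q, x'}"
      using that v(1-3) by (metis insertE singletonD)
    from kind[OF f] consider "f = {q, x}" | "f = {x, y}" | "f = {q, x'}" | "f = {x', y'}" | "?plain f" by metis
    then show ?thesis
    proof cases
      case 5
      then have "e = {x, y} \<or> e = {x', y'}" using pl2 e by metis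
      moreover from this have "c f \<noteq> a" using pl 5 by metis
      ultimately show ?thesis using 5 g1 by metis
    qed (use e v g1 \<open>a \<noteq> \<delta>\<close> xx' qn y yn x'y xy' yy in auto)
  qed
  have pr: "g e \<noteq> g f" if v: "v \<noteq> q" and ef: "e \<in> F \<union> F'" "f \<in> F \<union> F'" and m: "v \<in> e" "v \<in> f" "e \<noteq> f" for v e f
  proof (cases "?plain e \<and> ?plain f")
    case True
    then show ?thesis using proper_inj[OF p(1), of e f v] m by auto
  next
    case False
    then consider "\<not> ?plain e" | "\<not> ?plain f" by blast
    then show ?thesis
    proof cases
      case 1
      then show ?thesis using special[OF v m(1,2,3) _ ef(2)] kind[OF ef(1)] by metis
    next
      case 2
      then show ?thesis using special[OF v m(2,1) m(3)[symmetric] _ ef(1)] kind[OF ef(2)] by metis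
    qed
  qed
  show False
  proof (rule leafless_share_edge[OF _ _ FE(2) gFs FE'(2) gFs' pr critical_at_pivot[OF p(1) F \<delta>(1) zn(1) qn(1) y(1)] FE'(5)])
    show "finite F" using FE(1) fin finite_subset by blast
    show "card e = 2" if "e \<in> F" for e using that FE(1) card2 by blast
    show "{q, x} \<notin> F'" using F'x by blast
  qed
qed

section \<open>Pivots\<close>

lemma degree_mono: "finite E \<Longrightarrow> E' \<subseteq> E \<Longrightarrow> degree E' v \<le> degree E v"
  unfolding degree_def by (intro card_mono) auto

lemma proper_subset:
  "proper_edge_coloring E C c \<Longrightarrow> F \<subseteq> E \<Longrightarrow> proper_edge_coloring F C c"
  unfolding proper_edge_coloring_def by (meson image_mono subset_iff order_trans)

lemma critical_color_at_end:
  assumes p: "proper_edge_coloring (E - {{q, x}}) C c" and F: "critical E c q x y z \<delta> F"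
    and ne: "z \<noteq> x" "q \<noteq> x" "y \<noteq> q" "z \<noteq> q"
    and Y: "c {q, z} \<notin> c ` {e \<in> E. y \<in> e \<and> e \<noteq> {x, y}}"
  shows "\<exists>g\<in>F. z \<in> g \<and> g \<noteq> {q, z} \<and> c g = \<delta>"
proof -
  obtain g where g: "g \<in> F" "g \<noteq> {q, z}" "z \<in> g"
    by (rule leaflessE[OF criticalD(2,5)[OF F], of z]) auto
  have gE: "g \<in> E" using g(1) criticalD(1)[OF F] by blast
  have zE: "{q, z} \<in> E" using criticalD(1,5)[OF F] by blast
  have gx: "g \<noteq> {q, x}" using g(3) ne by auto
  have "g \<noteq> {x, y}"
  proof
    assume "g = {x, y}"
    then have "z = y" using g(3) ne by auto
    moreover have "{q, y} \<noteq> {x, y}" using ne by (auto simp: doubleton_eq_iff)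
    ultimately show False using Y zE by auto
  qed
  then have "c g = c {q, z} \<or> c g = \<delta>" using criticalD(6)[OF F g(1)] gx by simp
  moreover have "c g \<noteq> c {q, z}"
    using proper_inj[OF p, of g "{q, z}" z] g gE zE gx ne by (auto simp: doubleton_eq_iff)
  ultimately show ?thesis using g by blast
qed

text \<open>In the applications \<open>X\<close> consists of the neighbors of \<open>q\<close> that have degree at most 2 in the
  minimal counterexample, so that \<open>outer E q X\<close> is the set of big neighbors of \<open>q\<close>.\<close>

definition outer :: "'a set set \<Rightarrow> 'a \<Rightarrow> 'a set \<Rightarrow> 'a set" where
  "outer E q X = {z. {q, z} \<in> E \<and> z \<notin> X}"

text \<open>The degree bounds are inherited by subgraphs (\<open>pivot_subset\<close>), which allows the set \<open>X\<close> to stay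
  fixed while edges at \<open>q\<close> or elsewhere are left out. For this reason the vertices in \<open>X\<close> are not
  required to be neighbors of \<open>q\<close>. The bound on the degrees is \<open>\<Delta> \<le> card C - 1\<close>.\<close>

locale pivot =
  fixes E :: "'a set set" and C :: "'c set" and q :: 'a and X :: "'a set"
  assumes finite_E: "finite E" and card_edge: "e \<in> E \<Longrightarrow> card e = 2" and finite_C: "finite C"
    and degree_less: "degree E v < card C"
    and degree_X: "x \<in> X \<Longrightarrow> degree E x \<le> 2"
    and card_outer: "card (outer E q X) \<le> 2"
    and pivot_notin: "q \<notin> X"
begin

lemma finite_outer: "finite (outer E q X)"
proof -
  have "outer E q X \<subseteq> \<Union>E" unfolding outer_def by blast
  moreover have "finite (\<Union>E)"
    using finite_E card_edge by (metis card.infinite finite_Union zero_neq_numeral)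
  ultimately show ?thesis by (rule finite_subset)
qed

lemma pivot_subset:
  assumes "E' \<subseteq> E"
  shows "pivot E' C q X"
proof
  show "finite E'" using assms finite_E by (rule finite_subset)
  show "card e = 2" if "e \<in> E'" for e using that assms card_edge by blast
  show "finite C" by (rule finite_C)
  show "degree E' v < card C" for v
    using degree_mono[OF finite_E assms, of v] degree_less[of v] by linarith
  show "degree E' x \<le> 2" if "x \<in> X" for x
    using degree_mono[OF finite_E assms, of x] degree_X[OF that] by linarith
  show "q \<notin> X" by (rule pivot_notin)
  have "card (outer E' q X) \<le> card (outer E q X)"
    using assms unfolding outer_def by (intro card_mono finite_outer[unfolded outer_def]) blast
  then show "card (outer E' q X) \<le> 2" using card_outer by linarith
qed

lemma card_free_ge_2:
  assumes "e \<in> E" "v \<in> e"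
  shows "2 \<le> card (free_colors (E - {e}) C c v)"
proof (rule card_free_colors[where d = "degree (E - {e}) v"])
  show "degree (E - {e}) v + 2 \<le> card C"
    using degree_less[of v] degree_remove_edge[OF finite_E assms] by simp
qed (use finite_E finite_C in auto)

lemma no_loop: "{u, v} \<in> E \<Longrightarrow> u \<noteq> v"
  using card_edge by fastforce

text \<open>Each color \<open>\<epsilon>\<close> missing at \<open>y\<close> belongs to an edge \<open>qz\<close> whose end \<open>z\<close> sees \<open>\<epsilon>\<close> and
  the at least two colors free at \<open>q\<close>. So \<open>z\<close> has degree at least 3 and is outer. There are at
  least two such \<open>\<epsilon>\<close> and at most two outer neighbors, which makes the correspondence exact.\<close>

lemma stuck_if_unextendable:
  assumes x: "x \<in> X" "{q, x} \<in> E" and g: "good (E - {{q, x}}) C c"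
    and unext: "\<And>c'. (\<And>e. x \<notin> e \<Longrightarrow> c' e = c e) \<Longrightarrow> \<not> good E C c'"
  shows "\<exists>y. stuck E C c q x y (outer E q X)"
proof -
  let ?M = "free_colors (E - {{q, x}}) C c q"
  let ?R = "outer E q X"
  obtain y where B: "{x, y} \<in> E \<and> y \<noteq> q \<and> (\<forall>e\<in>E. x \<in> e \<longrightarrow> e = {q, x} \<or> e = {x, y}) \<and>
    (\<forall>\<epsilon>\<in>C - c ` {e \<in> E. y \<in> e \<and> e \<noteq> {x, y}}.
       \<exists>z. z \<noteq> x \<and> {q, z} \<in> E \<and> c {q, z} = \<epsilon> \<and>
         (\<forall>\<delta>\<in>?M. \<exists>F. critical E c q x y z \<delta> F))"
    using blocked_edge[OF finite_E card_edge finite_C degree_less degree_X[OF x(1)] x(2) g unext]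
    by (rule exE)
  note y = B[THEN conjunct1] B[THEN conjunct2, THEN conjunct1]
    B[THEN conjunct2, THEN conjunct2, THEN conjunct1, rule_format]
  note crit = B[THEN conjunct2, THEN conjunct2, THEN conjunct2, THEN bspec]
  let ?Y = "c ` {e \<in> E. y \<in> e \<and> e \<noteq> {x, y}}"
  note p = good_proper[OF g]
  have qx: "q \<noteq> x" "x \<noteq> y" using no_loop x(2) y(1) by auto
  have "{e \<in> E. y \<in> e \<and> e \<noteq> {x, y}} = {e \<in> E - {{x, y}}. y \<in> e}" by blast
  then have cardY: "2 \<le> card (C - ?Y)"
    using card_free_ge_2[OF y(1), of y c] unfolding free_colors_def by simp
  have M: "2 \<le> card ?M" by (rule card_free_ge_2) (use x in auto)
  have z: "\<exists>z\<in>?R. z \<noteq> x \<and> c {q, z} = \<epsilon> \<and> (\<forall>\<delta>\<in>?M. \<exists>F. critical E c q x y z \<delta> F)"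
    if \<epsilon>: "\<epsilon> \<in> C - ?Y" for \<epsilon>
  proof -
    obtain z where z: "z \<noteq> x" "{q, z} \<in> E" "c {q, z} = \<epsilon>" "\<forall>\<delta>\<in>?M. \<exists>F. critical E c q x y z \<delta> F"
      using crit[OF \<epsilon>] by auto
    have zq: "z \<noteq> q" using no_loop z(2) by blast
    have zA: "{q, z} \<in> {e \<in> E - {{q, x}}. q \<in> e}" using z(1,2) by (auto simp: doubleton_eq_iff)
    have "z \<notin> X"
    proof
      assume "z \<in> X"
      have "\<delta> \<in> c ` {e \<in> E. z \<in> e}" if "\<delta> \<in> ?M" for \<delta>
      proof -
        obtain F where F: "critical E c q x y z \<delta> F" using z(4) \<open>\<delta> \<in> ?M\<close> by blast
        have "c {q, z} \<notin> ?Y" using \<epsilon> z(3) by blast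
        then obtain g where "g \<in> F" "z \<in> g" "c g = \<delta>"
          using critical_color_at_end[OF p F z(1) qx(1) y(2) zq] by blast
        then show ?thesis using criticalD(1)[OF F] by blast
      qed
      moreover have "\<epsilon> \<in> c ` {e \<in> E. z \<in> e}" using z(2,3) by blast
      ultimately have sub: "insert \<epsilon> ?M \<subseteq> c ` {e \<in> E. z \<in> e}" by blast
      have "\<epsilon> \<notin> ?M" using zA z(3) unfolding free_colors_def by blast
      moreover have finM: "finite ?M" unfolding free_colors_def using finite_C by simp
      ultimately have "3 \<le> card (insert \<epsilon> ?M)" using M by simp
      also have "\<dots> \<le> card (c ` {e \<in> E. z \<in> e})" by (rule card_mono[OF _ sub]) (use finite_E in simp)
      also have "\<dots> \<le> degree E z" unfolding degree_def by (rule card_image_le) (use finite_E in simp)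
      finally show False using degree_X[OF \<open>z \<in> X\<close>] by simp
    qed
    then have "z \<in> ?R" using z(2) unfolding outer_def by simp
    then show ?thesis using z by blast
  qed
  let ?I = "(\<lambda>z. c {q, z}) ` ?R"
  have sub: "C - ?Y \<subseteq> ?I" using z by blast
  have cI: "card ?I \<le> card ?R" by (rule card_image_le[OF finite_outer])
  have "card (C - ?Y) \<le> card ?I" by (rule card_mono[OF _ sub]) (simp add: finite_outer)
  then have cR: "card ?R = 2" using cI card_outer cardY by linarith
  have eq: "C - ?Y = ?I"
    by (rule card_seteq[OF _ sub]) (use finite_outer cI card_outer cardY in auto)
  have "?Y \<subseteq> C"
  proof -
    have "e \<noteq> {q, x}" if "y \<in> e" for e using that y(2) qx(2) by auto
    then have "{e \<in> E. y \<in> e \<and> e \<noteq> {x, y}} \<subseteq> E - {{q, x}}" by blast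
    moreover have "c ` (E - {{q, x}}) \<subseteq> C" using p unfolding proper_edge_coloring_def by blast
    ultimately show ?thesis by blast
  qed
  then have Yeq: "?Y = C - ?I" using eq by blast
  have zx: "z \<noteq> x" if "z \<in> ?R" for z using that x(1) unfolding outer_def by auto
  have all: "\<exists>F. critical E c q x y z \<delta> F" if zR: "z \<in> ?R" and \<delta>: "\<delta> \<in> ?M" for z \<delta>
  proof -
    have "c {q, z} \<in> C - ?Y" using zR eq by blast
    from z[OF this] obtain z' where z': "z' \<in> ?R" "z' \<noteq> x" "c {q, z'} = c {q, z}"
      "\<forall>\<delta>\<in>?M. \<exists>F. critical E c q x y z' \<delta> F" by auto
    have "{q, z'} \<in> E - {{q, x}}" "{q, z} \<in> E - {{q, x}}"
      using zR z'(1,2) zx[OF zR] unfolding outer_def by (auto simp: doubleton_eq_iff)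
    then have "{q, z'} = {q, z}" using proper_inj[OF p, of "{q, z'}" "{q, z}" q] z'(3) by simp
    then have "z' = z" by (auto simp: doubleton_eq_iff)
    then show ?thesis using z'(4) \<delta> by blast
  qed
  have "stuck E C c q x y ?R"
    unfolding stuck_def
  proof (intro conjI ballI impI)
    show "e = {q, x} \<or> e = {x, y}" if "e \<in> E" "x \<in> e" for e using y(3)[OF that] .
    show "{q, z} \<in> E" if "z \<in> ?R" for z using that unfolding outer_def by simp
  qed (use y(1,2) cR Yeq zx all in simp_all)
  then show ?thesis by blast
qed

text \<open>As long as two edges from \<open>q\<close> to \<open>X\<close> are uncolored, one of them can be colored by
  \<open>not_two_stuck\<close>.\<close>

lemma extend_to_all_but_one:
  assumes "finite U" "U \<subseteq> X" "good (E - (\<lambda>u. {q, u}) ` U) C c"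
  shows "\<exists>c'. (\<forall>e. e \<inter> X = {} \<longrightarrow> c' e = c e) \<and>
    (good E C c' \<or> (\<exists>x\<in>X. {q, x} \<in> E \<and> good (E - {{q, x}}) C c'))"
  using assms
proof (induction "card U" arbitrary: U c rule: less_induct)
  case less
  let ?S = "\<lambda>U. (\<lambda>u. {q, u}) ` U"
  have shrink: ?case
    if u: "u \<in> U" and ag: "\<And>e. u \<notin> e \<Longrightarrow> c' e = c e" and g': "good (E - ?S (U - {u})) C c'" for u c'
  proof -
    have uX: "u \<in> X" using u less.prems by blast
    have "\<exists>c''. (\<forall>e. e \<inter> X = {} \<longrightarrow> c'' e = c' e) \<and>
      (good E C c'' \<or> (\<exists>x\<in>X. {q, x} \<in> E \<and> good (E - {{q, x}}) C c''))"
    proof (rule less.hyps[OF _ _ _ g'])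
      show "card (U - {u}) < card U" using u less.prems(1) by (rule card_Diff1_less[rotated])
    qed (use less.prems in auto)
    then obtain c'' where c'': "\<forall>e. e \<inter> X = {} \<longrightarrow> c'' e = c' e"
      "good E C c'' \<or> (\<exists>x\<in>X. {q, x} \<in> E \<and> good (E - {{q, x}}) C c'')" by blast
    have "c'' e = c e" if "e \<inter> X = {}" for e
    proof -
      have "u \<notin> e" using that uX by blast
      then show ?thesis using c''(1) that ag[of e] by simp
    qed
    then show ?thesis using c''(2) by blast
  qed
  show ?case
  proof (cases "\<exists>u\<in>U. {q, u} \<notin> E")
    case True
    then obtain u where u: "u \<in> U" "{q, u} \<notin> E" by blast
    then have "E - ?S (U - {u}) = E - ?S U" by blast
    then show ?thesis using shrink[OF u(1), of c] less.prems(3) by simp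
  next
    case False
    show ?thesis
    proof (cases "\<exists>x\<in>U. \<exists>x'\<in>U. x \<noteq> x'")
      case False
      then consider "U = {}" | x where "U = {x}" by blast
      then show ?thesis
      proof cases
        case 1
        then show ?thesis using less.prems(3) by auto
      next
        case 2
        then show ?thesis using less.prems(2,3) \<open>\<not> (\<exists>u\<in>U. {q, u} \<notin> E)\<close> by auto
      qed
    next
      case True
      then obtain x x' where xx': "x \<in> U" "x' \<in> U" "x \<noteq> x'" by blast
      let ?A = "E - ?S U"
      have E1: "{q, u} \<in> E - ?S (U - {u})" if "u \<in> U" for u
        using that False by (auto simp: doubleton_eq_iff)
      have E2: "E - ?S (U - {u}) - {{q, u}} = ?A" if "u \<in> U" for u
        using that by blast
      have E3: "outer (E - ?S (U - {u})) q X = outer E q X" for u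
        using less.prems(2) unfolding outer_def by (auto simp: doubleton_eq_iff)
      show ?thesis
      proof (rule ccontr)
        assume n: "\<not> ?thesis"
        have ex: "\<exists>y. stuck (E - ?S (U - {u})) C c q u y (outer E q X)" if u: "u \<in> U" for u
        proof -
          interpret P: pivot "E - ?S (U - {u})" C q X by (rule pivot_subset) blast
          have "\<exists>y. stuck (E - ?S (U - {u})) C c q u y (outer (E - ?S (U - {u})) q X)"
          proof (rule P.stuck_if_unextendable)
            show "u \<in> X" using u less.prems(2) by blast
            show "{q, u} \<in> E - ?S (U - {u})" by (rule E1[OF u])
            show "good (E - ?S (U - {u}) - {{q, u}}) C c" unfolding E2[OF u] by (rule less.prems(3))
            show "\<not> good (E - ?S (U - {u})) C c'" if "\<And>e. u \<notin> e \<Longrightarrow> c' e = c e" for c'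
              using shrink[OF u that] n by blast
          qed
          then show ?thesis unfolding E3 .
        qed
        obtain y where s: "stuck (E - ?S (U - {x})) C c q x y (outer E q X)" using ex[OF xx'(1)] by blast
        obtain y' where s': "stuck (E - ?S (U - {x'})) C c q x' y' (outer E q X)" using ex[OF xx'(2)] by blast
        note A = E2[OF xx'(1)] E2[OF xx'(2)]
        interpret P: pivot "E - ?S (U - {x})" C q X by (rule pivot_subset) blast
        have "2 \<le> card (free_colors (E - ?S (U - {x}) - {{q, x}}) C c q)"
          by (rule P.card_free_ge_2) (use E1[OF xx'(1)] in auto)
        then have "free_colors ?A C c q \<noteq> {}" unfolding A by auto
        then obtain \<delta> where \<delta>: "\<delta> \<in> free_colors ?A C c q" by blast
        have pA: "proper_edge_coloring ?A C c" using less.prems(3) by (rule good_proper)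
        show False
        proof (rule not_two_stuck[OF _ _ _ _ s s' xx'(3), where \<delta> = \<delta>])
          show "card e = 2" if "e \<in> E - ?S (U - {x}) \<union> (E - ?S (U - {x'}))" for e
            using that card_edge by blast
          show "finite (E - ?S (U - {x}))" using finite_E by simp
          show "E - ?S (U - {x}) - {{q, x}, {q, x'}} = E - ?S (U - {x'}) - {{q, x}, {q, x'}}"
            using xx' by blast
                  show "proper_edge_coloring (E - ?S (U - {x}) - {{q, x}}) C c"
            "proper_edge_coloring (E - ?S (U - {x'}) - {{q, x'}}) C c"
            "\<delta> \<in> free_colors (E - ?S (U - {x}) - {{q, x}}) C c q"
            "\<delta> \<in> free_colors (E - ?S (U - {x'}) - {{q, x'}}) C c q"
            unfolding A by (fact pA \<delta>)+
          show "{q, x} \<in> E - ?S (U - {x})" "{q, x'} \<in> E - ?S (U - {x'})"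
            by (fact E1[OF xx'(1)] E1[OF xx'(2)])+
        qed simp
      qed
    qed
  qed
qed

lemma stuck_coloring_proper:
  assumes s: "stuck E C c q x y R" and g: "good (E - {{q, x}}) C c" and q: "q \<noteq> x" and z: "z \<in> R"
    and \<delta>: "\<delta> \<in> free_colors (E - {{q, x}}) C c q"
  shows "proper_edge_coloring E C (c({x, y} := c {q, z}, {q, x} := \<delta>))"
proof (rule proper_color_edge)
  let ?A = "E - {{q, x}}" and ?a = "c {q, z}"
  note S = stuckD[OF s]
  have zA: "{q, z} \<in> ?A" using S(5,6)[OF z] by (auto simp: doubleton_eq_iff)
  have xyq: "q \<notin> {x, y}" using q S(2) by auto
  have "good ?A C (c({x, y} := ?a))"
  proof (rule recolor_pendant_edge[OF g])
    show "?a \<in> C" using good_proper[OF g] zA unfolding proper_edge_coloring_def by blast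
    show "e = {x, y}" if "e \<in> ?A" "x \<in> e" for e using S(3)[of e] that by blast
    show "c e \<noteq> ?a" if "e \<in> ?A" "y \<in> e" "e \<noteq> {x, y}" for e
    proof -
      have "c e \<in> C - (\<lambda>z. c {q, z}) ` R" unfolding S(7)[symmetric] using that by blast
      then show ?thesis using z by blast
    qed
  qed
  then show "proper_edge_coloring ?A C (c({x, y} := ?a))" by (rule good_proper)
  show "\<delta> \<in> free_colors ?A C (c({x, y} := ?a)) q"
    using \<delta> xyq unfolding free_colors_def by (auto simp: image_iff)
  have "?a \<noteq> \<delta>" using \<delta> zA unfolding free_colors_def by blast
  then show "(c({x, y} := ?a)) e \<noteq> \<delta>" if "e \<in> E" "x \<in> e" "e \<noteq> {q, x}" for e
    using S(3)[of e] that by auto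
qed

text \<open>For a color \<open>\<delta>\<close> used on an edge \<open>qw\<close> with \<open>w \<in> X\<close>, uncolor \<open>qw\<close>, which makes \<open>\<delta>\<close>
  free. If \<open>qx\<close> is still stuck, then it has a critical cycle with \<open>\<delta>\<close>. Otherwise color
  \<open>qx\<close>; since the whole graph is not colorable in this way, \<open>qw\<close> is stuck now, and
  \<open>not_two_stuck\<close> applies to the old and the new coloring. The coloring \<open>c'\<close> is the one in which
  the cycle is bichromatic; it is proper on the cycle, and possibly not on all of \<open>E\<close>.\<close>

lemma stuck_all_colors:
  assumes x: "x \<in> X" "{q, x} \<in> E" and g: "good (E - {{q, x}}) C c"
    and unext: "\<And>c'. (\<And>e. e \<inter> X = {} \<Longrightarrow> c' e = c e) \<Longrightarrow> \<not> good E C c'"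
  shows "\<exists>y. stuck E C c q x y (outer E q X) \<and>
    (\<forall>z\<in>outer E q X. \<forall>\<delta>\<in>C - (\<lambda>z. c {q, z}) ` outer E q X.
      \<exists>c' F. (\<forall>e. e \<inter> X = {} \<longrightarrow> c' e = c e) \<and> proper_edge_coloring F C c' \<and> leafless F \<and> F \<subseteq> E \<and>
        c' ` F \<subseteq> {c {q, z}, \<delta>} \<and> {q, z} \<in> F)"
proof -
  let ?R = "outer E q X"
  have qx: "q \<noteq> x" using no_loop x(2) by blast
  have offx: "x \<notin> e" if "e \<inter> X = {}" for e using that x(1) by blast
  have "\<not> good E C c'" if "\<And>e. x \<notin> e \<Longrightarrow> c' e = c e" for c'
    by (rule unext) (rule that[OF offx])
  then obtain y where s: "stuck E C c q x y ?R"
    using stuck_if_unextendable[OF x g] by blast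
  have witness: "\<exists>c' F. (\<forall>e. e \<inter> X = {} \<longrightarrow> c' e = c e) \<and> proper_edge_coloring F C c' \<and> leafless F \<and> F \<subseteq> E \<and>
        c' ` F \<subseteq> {c {q, z}, \<delta>} \<and> {q, z} \<in> F"
    if E': "E' \<subseteq> E" and s: "stuck E' C c q x y' ?R" and z: "z \<in> ?R"
      and \<delta>: "\<delta> \<in> free_colors (E' - {{q, x}}) C c q" for E' y' z \<delta>
  proof -
    interpret P: pivot E' C q X by (rule pivot_subset[OF E'])
    obtain F where F: "critical E' c q x y' z \<delta> F" using stuckD(8)[OF s z \<delta>] by blast
    let ?c = "c({x, y'} := c {q, z}, {q, x} := \<delta>)"
    have "good (E' - {{q, x}}) C c" by (rule good_subset[OF g]) (use E' in blast)
    then have "proper_edge_coloring E' C ?c" by (rule P.stuck_coloring_proper[OF s _ qx z \<delta>])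
    then have "proper_edge_coloring F C ?c"
      by (rule proper_subset) (rule criticalD(1)[OF F])
    moreover have "\<forall>e. e \<inter> X = {} \<longrightarrow> ?c e = c e" using x(1) by auto
    moreover have "?c ` F \<subseteq> {c {q, z}, \<delta>}" by (rule image_subsetI) (rule criticalD(6)[OF F])
    moreover have "F \<subseteq> E" using criticalD(1)[OF F] E' by (rule order_trans)
    ultimately show ?thesis using criticalD(2,5)[OF F] by blast
  qed
  have "\<exists>c' F. (\<forall>e. e \<inter> X = {} \<longrightarrow> c' e = c e) \<and> proper_edge_coloring F C c' \<and> leafless F \<and> F \<subseteq> E \<and>
        c' ` F \<subseteq> {c {q, z}, \<delta>} \<and> {q, z} \<in> F"
    if z: "z \<in> ?R" and \<delta>: "\<delta> \<in> C - (\<lambda>z. c {q, z}) ` ?R" for z \<delta>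
  proof (cases "\<delta> \<in> free_colors (E - {{q, x}}) C c q")
    case True
    then show ?thesis by (rule witness[OF subset_refl s z])
  next
    case False
    then obtain e where e: "e \<in> E - {{q, x}}" "q \<in> e" "c e = \<delta>"
      using \<delta> unfolding free_colors_def by blast
    obtain w where w: "e = {q, w}" "w \<noteq> q" using e card_edge by (metis DiffD1 two_element_edge)
    have wx: "w \<noteq> x" using e(1) w(1) by auto
    have wE: "{q, w} \<in> E" using e(1) w(1) by blast
    have wX: "w \<in> X"
    proof (rule ccontr)
      assume "w \<notin> X"
      then have "w \<in> ?R" using wE unfolding outer_def by simp
      then show False using \<delta> e(3) w(1) by blast
    qed
    let ?E' = "E - {{q, w}}"
    interpret P: pivot ?E' C q X by (rule pivot_subset) blast
    have gE': "good (?E' - {{q, x}}) C c" by (rule good_subset[OF g]) blast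
    have xE': "{q, x} \<in> ?E'" using x(2) wx by (auto simp: doubleton_eq_iff)
    have R': "outer ?E' q X = ?R" using wX unfolding outer_def by (auto simp: doubleton_eq_iff)
    have "\<exists>y'. stuck ?E' C c q x y' (outer ?E' q X)"
    proof (rule P.stuck_if_unextendable[OF x(1) xE' gE'])
      fix c1 assume ag: "\<And>e. x \<notin> e \<Longrightarrow> c1 e = c e"
      show "\<not> good ?E' C c1"
      proof
        assume g1: "good ?E' C c1"
        have "\<exists>y2. stuck E C c1 q w y2 ?R"
        proof (rule stuck_if_unextendable[OF wX wE g1])
          fix c2 assume ag2: "\<And>e. w \<notin> e \<Longrightarrow> c2 e = c1 e"
          show "\<not> good E C c2"
          proof (rule unext)
            fix e :: "'a set" assume "e \<inter> X = {}"
            then have "w \<notin> e" "x \<notin> e" using wX x(1) by auto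
            then show "c2 e = c e" using ag ag2 by simp
          qed
        qed
        then obtain y2 where s2: "stuck E C c1 q w y2 ?R" by blast
        have "2 \<le> card (free_colors (E - {{q, x}}) C c q)" by (rule card_free_ge_2) (use x(2) in auto)
        then have "\<not> free_colors (E - {{q, x}}) C c q \<subseteq> {c1 {q, x}}"
          using card_mono[of "{c1 {q, x}}" "free_colors (E - {{q, x}}) C c q"] by auto
        then obtain \<delta>0 where \<delta>0: "\<delta>0 \<in> free_colors (E - {{q, x}}) C c q" "\<delta>0 \<noteq> c1 {q, x}" by blast
        have "c1 e \<noteq> \<delta>0" if "e \<in> ?E'" "q \<in> e" for e
        proof (cases "x \<in> e")
          case True
          then have "e = {q, x}" using stuckD(3)[OF s, of e] stuckD(2)[OF s] that qx by auto
          then show ?thesis using \<delta>0(2) by simp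
        next
          case False
          then have "c1 e = c e" "e \<in> E - {{q, x}}" using ag that by auto
          then show ?thesis using \<delta>0(1) that(2) unfolding free_colors_def by auto
        qed
        then have \<delta>1: "\<delta>0 \<in> free_colors ?E' C c1 q" using \<delta>0(1) unfolding free_colors_def by auto
        show False
          by (rule not_two_stuck[OF _ finite_E good_proper[OF g] good_proper[OF g1] s s2 wx[symmetric]
                x(2) wE refl ag \<delta>0(1) \<delta>1]) (use card_edge in auto)
      qed
    qed
    then obtain y' where s': "stuck ?E' C c q x y' ?R" unfolding R' by blast
    have "c f \<noteq> \<delta>" if "f \<in> ?E' - {{q, x}}" "q \<in> f" for f
      using proper_inj[OF good_proper[OF g], of f e q] that e w(1) by auto
    then have "\<delta> \<in> free_colors (?E' - {{q, x}}) C c q"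
      using \<delta> unfolding free_colors_def by blast
    then show ?thesis by (rule witness[OF _ s' z, rotated]) blast
  qed
  then show ?thesis using s by blast
qed

end

section \<open>Saturated neighbors and exchanging colors\<close>

text \<open>After recoloring the edges in \<open>T\<close> it suffices to look at conflicts and bichromatic cycles that
  involve \<open>T\<close>.\<close>

lemma good_recolor:
  assumes g: "good A C c" and same: "\<And>e. e \<notin> T \<Longrightarrow> c' e = c e"
    and C: "\<And>e. e \<in> T \<Longrightarrow> c' e \<in> C"
    and pr: "\<And>e f v. e \<in> T \<Longrightarrow> e \<in> A \<Longrightarrow> f \<in> A \<Longrightarrow> e \<noteq> f \<Longrightarrow> v \<in> e \<Longrightarrow> v \<in> f \<Longrightarrow> c' e \<noteq> c' f"
    and lf: "\<And>F \<alpha> \<beta>. F \<subseteq> A \<Longrightarrow> leafless F \<Longrightarrow> c' ` F \<subseteq> {\<alpha>, \<beta>} \<Longrightarrow> F \<inter> T = {}"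
  shows "good A C c'"
  unfolding good_def
proof (intro conjI allI impI)
  show "proper_edge_coloring A C c'"
    unfolding proper_edge_coloring_def
  proof (intro conjI ballI impI)
    show "c' ` A \<subseteq> C"
      using good_proper[OF g] same C unfolding proper_edge_coloring_def by (metis image_subset_iff)
    fix e f assume ef: "e \<in> A" "f \<in> A" "e \<noteq> f \<and> e \<inter> f \<noteq> {}"
    then obtain v where v: "v \<in> e" "v \<in> f" by blast
    consider "e \<in> T" | "f \<in> T" | "e \<notin> T" "f \<notin> T" by blast
    then show "c' e \<noteq> c' f"
    proof cases
      case 1
      then show ?thesis using pr[OF _ ef(1,2) _ v] ef(3) by blast
    next
      case 2
      then show ?thesis using pr[OF _ ef(2,1) _ v(2,1)] ef(3) by metis
    next
      case 3
      then show ?thesis using proper_inj[OF good_proper[OF g] ef(1,2) v] same ef(3) by metis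
    qed
  qed
next
  fix F \<alpha> \<beta> assume F: "F \<subseteq> A \<and> leafless F \<and> c' ` F \<subseteq> {\<alpha>, \<beta>}"
  then have "F \<inter> T = {}" using lf by metis
  then have "c' ` F = c ` F" using same by (intro image_cong) auto
  then show "F = {}" using F g unfolding good_def by metis
qed

context pivot
begin

text \<open>If \<open>z\<close> were the second neighbor of \<open>x\<close>, then it would miss the color of its own
  edge \<open>qz\<close>.\<close>

lemma stuck_neighbor_not_outer:
  assumes x: "x \<in> X" "{q, x} \<in> E" and g: "good (E - {{q, x}}) C c"
    and unext: "\<And>c'. (\<And>e. e \<inter> X = {} \<Longrightarrow> c' e = c e) \<Longrightarrow> \<not> good E C c'"
    and z: "z \<in> outer E q X"
  shows "{x, z} \<notin> E"
proof
  assume xz: "{x, z} \<in> E"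
  obtain y where s: "stuck E C c q x y (outer E q X)"
    using stuck_all_colors[OF x g unext] by auto
  have zq: "{q, z} \<in> E" using z unfolding outer_def by simp
  have ne: "q \<noteq> x" "z \<noteq> q" "z \<noteq> x" using no_loop x(2) zq xz by blast+
  have "z = y" using stuckD(3)[OF s xz] ne by (auto simp: doubleton_eq_iff)
  moreover have "{q, z} \<noteq> {x, z}" using ne by (auto simp: doubleton_eq_iff)
  ultimately have "c {q, z} \<in> c ` {e \<in> E. y \<in> e \<and> e \<noteq> {x, y}}" using zq by auto
  then show False unfolding stuckD(7)[OF s] using z by blast
qed

lemma edge_at_outer_avoids:
  assumes T: "\<And>x z. x \<in> X \<Longrightarrow> z \<in> outer E q X \<Longrightarrow> {x, z} \<notin> E"
    and z: "z \<in> outer E q X" and e: "e \<in> E" "z \<in> e"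
  shows "e \<inter> X = {}"
proof -
  obtain w where w: "e = {z, w}" using two_element_edge[OF card_edge[OF e(1)] e(2)] by blast
  have "w \<notin> X" using T[of w z] z e(1) unfolding w by (auto simp: insert_commute)
  moreover have "z \<notin> X" using z unfolding outer_def by simp
  ultimately show ?thesis unfolding w by simp
qed

text \<open>The critical cycle through \<open>qz\<close> in the colors \<open>a\<close> of \<open>qz\<close> and \<open>\<delta>\<close> leaves \<open>z\<close> by its
  edge \<open>zw\<close> colored \<open>\<delta>\<close> and continues at \<open>w\<close> with color \<open>a\<close>. With every \<open>\<delta>\<close> outside
  \<open>{a, b}\<close> available and \<open>a\<close> on \<open>qz\<close>, the degree bound leaves no room for \<open>b\<close> at \<open>z\<close>.
  The assumption on \<open>X\<close> and the outer neighbors ensures that rearranging colors at \<open>X\<close> does not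
  touch the edges at \<open>z\<close>.\<close>

lemma stuck_saturated:
  assumes x: "x \<in> X" "{q, x} \<in> E" and g: "good (E - {{q, x}}) C c"
    and unext: "\<And>c'. (\<And>e. e \<inter> X = {} \<Longrightarrow> c' e = c e) \<Longrightarrow> \<not> good E C c'"
    and T: "\<And>x z. x \<in> X \<Longrightarrow> z \<in> outer E q X \<Longrightarrow> {x, z} \<notin> E"
    and z: "z \<in> outer E q X"
  shows "\<exists>z'. z' \<noteq> z \<and> outer E q X = {z, z'} \<and> c ` {e \<in> E. z \<in> e} = C - {c {q, z'}} \<and>
    (\<forall>w. {z, w} \<in> E \<and> w \<noteq> q \<longrightarrow>
      (\<exists>h\<in>E. w \<in> h \<and> h \<noteq> {z, w} \<and> (h \<inter> X = {} \<longrightarrow> c h = c {q, z})))"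
proof -
  let ?R = "outer E q X" and ?a = "c {q, z}"
  obtain y where s: "stuck E C c q x y ?R"
    and W: "\<forall>z\<in>?R. \<forall>\<delta>\<in>C - (\<lambda>z. c {q, z}) ` ?R.
      \<exists>c' F. (\<forall>e. e \<inter> X = {} \<longrightarrow> c' e = c e) \<and> proper_edge_coloring F C c' \<and> leafless F \<and> F \<subseteq> E \<and>
        c' ` F \<subseteq> {c {q, z}, \<delta>} \<and> {q, z} \<in> F"
    using stuck_all_colors[OF x g unext] by auto
  note p = good_proper[OF g]
  have qzE: "{q, z} \<in> E" using z unfolding outer_def by simp
  have ne: "q \<noteq> x" "z \<noteq> q" "z \<noteq> x"
    using no_loop x(2) qzE stuckD(5)[OF s z] by blast+
  obtain z' where z': "z' \<noteq> z" "?R = {z, z'}"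
  proof -
    obtain u v where uv: "?R = {u, v}" "u \<noteq> v" using stuckD(4)[OF s] unfolding card_2_iff by blast
    show ?thesis
    proof (cases "z = u")
      case True
      then show ?thesis using that[of v] uv by auto
    next
      case False
      then have "z = v" using z uv by blast
      then show ?thesis using that[of u] uv by auto
    qed
  qed
  let ?b = "c {q, z'}"
  have z'E: "{q, z'} \<in> E" using z'(2) unfolding outer_def by blast
  have zA: "e \<in> E - {{q, x}}" if "e \<in> E" "z \<in> e" for e using that ne by auto
  have qz'A: "{q, z'} \<in> E - {{q, x}}"
    using z'E stuckD(5)[OF s, of z'] z'(2) by (auto simp: doubleton_eq_iff)
  have ab: "?a \<noteq> ?b"
    using proper_inj[OF p zA[OF qzE] qz'A, of q] z'(1) by (auto simp: doubleton_eq_iff)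
  have avoid: "e \<inter> X = {}" if "e \<in> E" "z \<in> e" for e
    by (rule edge_at_outer_avoids[OF T z that])
  have key: "\<exists>g\<in>E. z \<in> g \<and> c g = \<delta> \<and> (\<exists>F c'. g \<in> F \<and> (\<forall>e. e \<inter> X = {} \<longrightarrow> c' e = c e) \<and>
      proper_edge_coloring F C c' \<and> leafless F \<and> F \<subseteq> E \<and> c' ` F \<subseteq> {?a, \<delta>})"
    if \<delta>: "\<delta> \<in> C - {?a, ?b}" for \<delta>
  proof -
    have "\<delta> \<in> C - (\<lambda>z. c {q, z}) ` ?R" unfolding z'(2) using \<delta> by simp
    then obtain c' F where F: "\<forall>e. e \<inter> X = {} \<longrightarrow> c' e = c e" "proper_edge_coloring F C c'" "leafless F"
      "F \<subseteq> E" "c' ` F \<subseteq> {?a, \<delta>}" "{q, z} \<in> F" using W z by metis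
    obtain g where g: "g \<in> F" "g \<noteq> {q, z}" "z \<in> g"
      by (rule leaflessE[OF F(3,6), of z]) auto
    have gE: "g \<in> E" using g(1) F(4) by blast
    have "c' g \<noteq> c' {q, z}" using proper_inj[OF F(2) g(1) F(6) g(3)] g(2) by auto
    then have "c' g = \<delta>" using F(1,5) g(1) avoid[OF qzE] by auto
    then have "c g = \<delta>" using F(1) avoid[OF gE g(3)] by simp
    then show ?thesis using F g(1,3) gE by blast
  qed
  have fin: "finite {e \<in> E. z \<in> e}" using finite_E by simp
  have "?a \<in> c ` {e \<in> E. z \<in> e}" using qzE by blast
  moreover have "\<delta> \<in> c ` {e \<in> E. z \<in> e}" if "\<delta> \<in> C - {?a, ?b}" for \<delta>
    using key[OF that] by blast
  ultimately have sup: "C - {?b} \<subseteq> c ` {e \<in> E. z \<in> e}" by blast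
  have sub: "c ` {e \<in> E. z \<in> e} \<subseteq> C"
  proof -
    have "{e \<in> E. z \<in> e} \<subseteq> E - {{q, x}}" using zA by blast
    then show ?thesis using p unfolding proper_edge_coloring_def by blast
  qed
  have "?b \<notin> c ` {e \<in> E. z \<in> e}"
  proof
    assume "?b \<in> c ` {e \<in> E. z \<in> e}"
    then have "C \<subseteq> c ` {e \<in> E. z \<in> e}" using sup by blast
    then have "card C \<le> card (c ` {e \<in> E. z \<in> e})" by (rule card_mono[rotated]) (use fin in simp)
    also have "\<dots> \<le> degree E z" unfolding degree_def by (rule card_image_le[OF fin])
    finally show False using degree_less[of z] by simp
  qed
  then have cols: "c ` {e \<in> E. z \<in> e} = C - {?b}" using sup sub by blast
  have "\<exists>h\<in>E. w \<in> h \<and> h \<noteq> {z, w} \<and> (h \<inter> X = {} \<longrightarrow> c h = ?a)" if w: "{z, w} \<in> E" "w \<noteq> q" for w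
  proof -
    let ?e = "{z, w}"
    have eA: "?e \<in> E - {{q, x}}" by (rule zA[OF w(1)]) simp
    have "?e \<noteq> {q, z}" using w(2) ne(2) by (auto simp: doubleton_eq_iff)
    then have "c ?e \<noteq> ?a" using proper_inj[OF p eA zA[OF qzE], of z] by auto
    moreover have "c ?e \<in> C - {?b}" unfolding cols[symmetric] using w(1) by blast
    ultimately have "c ?e \<in> C - {?a, ?b}" by blast
    from key[OF this] obtain g F c' where g: "g \<in> E" "z \<in> g" "c g = c ?e" "g \<in> F"
      and F: "\<forall>e. e \<inter> X = {} \<longrightarrow> c' e = c e" "proper_edge_coloring F C c'" "leafless F"
        "F \<subseteq> E" "c' ` F \<subseteq> {?a, c ?e}" by blast
    have "g = ?e" using proper_inj[OF p zA[OF g(1,2)] eA g(2)] g(3) by simp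
    then have eF: "?e \<in> F" using g(4) by simp
    obtain h where h: "h \<in> F" "h \<noteq> ?e" "w \<in> h"
      by (rule leaflessE[OF F(3) eF, of w]) auto
    have "c' h \<noteq> c' ?e" using proper_inj[OF F(2) h(1) eF h(3)] h(2) by auto
    moreover have "c' ?e = c ?e" using F(1) avoid[OF w(1)] by simp
    ultimately have "c' h = ?a" using F(5) h(1) by auto
    then have "h \<inter> X = {} \<longrightarrow> c h = ?a" using F(1) by auto
    then show ?thesis using h F(4) by blast
  qed
  then show ?thesis using z' cols by blast
qed

text \<open>The conclusion of \<open>stuck_saturated\<close> only speaks about edges that are not recolored by
  \<open>extend_to_all_but_one\<close>, so it already holds when no edge from \<open>q\<close> to \<open>X\<close> is colored.\<close>

lemma saturated:
  assumes g: "good (E - (\<lambda>u. {q, u}) ` X) C c"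
    and unext: "\<And>c'. (\<And>e. e \<inter> X = {} \<Longrightarrow> c' e = c e) \<Longrightarrow> \<not> good E C c'"
    and T: "\<And>x z. x \<in> X \<Longrightarrow> z \<in> outer E q X \<Longrightarrow> {x, z} \<notin> E"
    and z: "z \<in> outer E q X"
  shows "\<exists>z'. z' \<noteq> z \<and> outer E q X = {z, z'} \<and> c ` {e \<in> E. z \<in> e} = C - {c {q, z'}} \<and>
    (\<forall>w. {z, w} \<in> E \<and> w \<noteq> q \<longrightarrow>
      (\<exists>h\<in>E. w \<in> h \<and> h \<noteq> {z, w} \<and> (h \<inter> X = {} \<longrightarrow> c h = c {q, z})))"
proof -
  let ?U = "{u \<in> X. {q, u} \<in> E}"
  have "?U \<subseteq> \<Union>E" by blast
  moreover have "finite (\<Union>E)"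
    using finite_E card_edge by (metis card.infinite finite_Union zero_neq_numeral)
  ultimately have finU: "finite ?U" by (rule finite_subset)
  have "E - (\<lambda>u. {q, u}) ` ?U = E - (\<lambda>u. {q, u}) ` X" by blast
  then have "good (E - (\<lambda>u. {q, u}) ` ?U) C c" using g by simp
  then obtain c' where ag: "\<forall>e. e \<inter> X = {} \<longrightarrow> c' e = c e"
    and c': "good E C c' \<or> (\<exists>x\<in>X. {q, x} \<in> E \<and> good (E - {{q, x}}) C c')"
    using extend_to_all_but_one[OF finU, of c] by auto
  have "\<not> good E C c'" by (rule unext) (use ag in simp)
  then obtain x where x: "x \<in> X" "{q, x} \<in> E" and g': "good (E - {{q, x}}) C c'" using c' by blast
  have unext': "\<not> good E C c''" if "\<And>e. e \<inter> X = {} \<Longrightarrow> c'' e = c' e" for c''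
    by (rule unext) (use that ag in simp)
  obtain z' where z': "z' \<noteq> z" "outer E q X = {z, z'}" "c' ` {e \<in> E. z \<in> e} = C - {c' {q, z'}}"
    and W: "\<forall>w. {z, w} \<in> E \<and> w \<noteq> q \<longrightarrow>
      (\<exists>h\<in>E. w \<in> h \<and> h \<noteq> {z, w} \<and> (h \<inter> X = {} \<longrightarrow> c' h = c' {q, z}))"
    using stuck_saturated[OF x g' unext' T z] by auto
  have qz: "c' {q, u} = c {q, u}" if "u \<in> outer E q X" for u
    using ag pivot_notin that unfolding outer_def by simp
  have "c' ` {e \<in> E. z \<in> e} = c ` {e \<in> E. z \<in> e}"
    using ag edge_at_outer_avoids[OF T z] by (intro image_cong) auto
  then have "c ` {e \<in> E. z \<in> e} = C - {c {q, z'}}" using z'(2,3) qz[of z'] by simp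
  moreover have "\<exists>h\<in>E. w \<in> h \<and> h \<noteq> {z, w} \<and> (h \<inter> X = {} \<longrightarrow> c h = c {q, z})"
    if "{z, w} \<in> E" "w \<noteq> q" for w
    using W that ag qz[OF z] by metis
  ultimately show ?thesis using z'(1,2) by blast
qed

lemma star_complement_edgeE:
  assumes "e \<in> E - (\<lambda>u. {q, u}) ` X" "q \<in> e"
  obtains z where "e = {q, z}" "z \<in> outer E q X" "z \<noteq> q"
proof -
  obtain z where z: "e = {q, z}" "z \<noteq> q"
    using two_element_edge[OF card_edge assms(2)] assms(1) by blast
  moreover have "z \<in> outer E q X" using assms(1) z(1) unfolding outer_def by blast
  ultimately show ?thesis using that by blast
qed

lemma outer_edge_in_star_complement:
  assumes "z \<in> outer E q X"
  shows "{q, z} \<in> E - (\<lambda>u. {q, u}) ` X"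
  using assms unfolding outer_def by (auto simp: doubleton_eq_iff)

text \<open>By saturation \<open>z\<close> misses the color of \<open>qz'\<close> and conversely, so the exchange is proper. A new
  bichromatic cycle would pass through \<open>qz\<close> and \<open>qz'\<close>, use their two colors, and stop at \<open>z\<close>,
  which sees one of them only.\<close>

lemma swap_outer_colors:
  assumes g: "good (E - (\<lambda>u. {q, u}) ` X) C c"
    and unext: "\<And>c'. (\<And>e. e \<inter> X = {} \<Longrightarrow> c' e = c e) \<Longrightarrow> \<not> good E C c'"
    and T: "\<And>x z. x \<in> X \<Longrightarrow> z \<in> outer E q X \<Longrightarrow> {x, z} \<notin> E"
    and R: "outer E q X = {z, z'}" "z \<noteq> z'"
  shows "good (E - (\<lambda>u. {q, u}) ` X) C (c({q, z} := c {q, z'}, {q, z'} := c {q, z}))"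
proof (rule good_recolor[OF g, where T = "{{q, z}, {q, z'}}"])
  let ?A = "E - (\<lambda>u. {q, u}) ` X"
  let ?a = "c {q, z}" and ?b = "c {q, z'}"
  let ?c = "c({q, z} := ?b, {q, z'} := ?a)"
  note p = good_proper[OF g]
  have zR: "z \<in> outer E q X" "z' \<in> outer E q X" using R by auto
  have colz: "c ` {e \<in> E. z \<in> e} = C - {?b}"
    using saturated[OF g unext T zR(1)] R by (auto simp: doubleton_eq_iff)
  have colz': "c ` {e \<in> E. z' \<in> e} = C - {?a}"
    using saturated[OF g unext T zR(2)] R by (auto simp: doubleton_eq_iff)
  have A: "{q, z} \<in> ?A" "{q, z'} \<in> ?A" using outer_edge_in_star_complement zR by blast+
  have zq: "z \<noteq> q" "z' \<noteq> q" using no_loop zR unfolding outer_def by blast+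
  have neq: "{q, z} \<noteq> {q, z'}" using R(2) by (auto simp: doubleton_eq_iff)
  have ab: "?a \<noteq> ?b" using proper_inj[OF p A, of q] neq by auto
  have cq: "?c {q, z} = ?b" "?c {q, z'} = ?a" using neq by auto
  have at_q: "e = {q, z} \<or> e = {q, z'}" if e: "e \<in> ?A" "q \<in> e" for e
    by (rule star_complement_edgeE[OF e]) (use R in auto)
  have at_z: "c e \<noteq> ?a \<and> c e \<noteq> ?b" if "e \<in> ?A" "z \<in> e" "e \<noteq> {q, z}" for e
  proof -
    have "c e \<in> C - {?b}" unfolding colz[symmetric] using that by blast
    then show ?thesis using proper_inj[OF p that(1) A(1) that(2)] that(3) by auto
  qed
  have at_z': "c e \<noteq> ?a \<and> c e \<noteq> ?b" if "e \<in> ?A" "z' \<in> e" "e \<noteq> {q, z'}" for e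
  proof -
    have "c e \<in> C - {?a}" unfolding colz'[symmetric] using that by blast
    then show ?thesis using proper_inj[OF p that(1) A(2) that(2)] that(3) by auto
  qed
  show "?c e = c e" if "e \<notin> {{q, z}, {q, z'}}" for e using that by simp
  have "?a \<in> C" "?b \<in> C" using p A unfolding proper_edge_coloring_def by blast+
  then show "?c e \<in> C" if "e \<in> {{q, z}, {q, z'}}" for e using that cq by auto
  show "?c e \<noteq> ?c f" if e: "e \<in> {{q, z}, {q, z'}}" and f: "f \<in> ?A" "e \<noteq> f" "v \<in> e" "v \<in> f" for e f v
  proof (cases "q \<in> f")
    case True
    then have "f = {q, z} \<or> f = {q, z'}" using at_q f(1) by blast
    then show ?thesis using e f(2) cq ab by auto
  next
    case False
    then have "?c f = c f" by auto
    moreover have "v = z \<and> e = {q, z} \<or> v = z' \<and> e = {q, z'}" using e f(3,4) False by auto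
    moreover have "f \<noteq> {q, z}" "f \<noteq> {q, z'}" using False by auto
    ultimately show ?thesis using at_z[OF f(1)] at_z'[OF f(1)] f(4) cq by metis
  qed
  show "F \<inter> {{q, z}, {q, z'}} = {}" if F: "F \<subseteq> ?A" "leafless F" "?c ` F \<subseteq> {\<alpha>, \<beta>}" for F \<alpha> \<beta>
  proof (rule ccontr)
    assume "F \<inter> {{q, z}, {q, z'}} \<noteq> {}"
    then obtain e where e: "e \<in> F" "q \<in> e" by auto
    obtain f where f: "f \<in> F" "f \<noteq> e" "q \<in> f" by (rule leaflessE[OF F(2) e])
    have "{q, z} \<in> F" "{q, z'} \<in> F" using at_q[of e] at_q[of f] e f F(1) by auto
    then have "?b \<in> {\<alpha>, \<beta>}" "?a \<in> {\<alpha>, \<beta>}" using F(3) cq by (metis image_subset_iff)+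
    then have sub: "{\<alpha>, \<beta>} = {?a, ?b}" using ab by auto
    obtain g where g: "g \<in> F" "g \<noteq> {q, z}" "z \<in> g"
      by (rule leaflessE[OF F(2) \<open>{q, z} \<in> F\<close>, of z]) auto
    have "?c g = c g" using g R(2) zq by auto
    then have "c g \<in> {?a, ?b}" using F(3) g(1) unfolding sub by (metis image_subset_iff)
    then show False using at_z[of g] g F(1) by blast
  qed
qed

text \<open>If \<open>x\<close> were the only neighbor of \<open>q\<close> in \<open>X\<close>, then it would be stuck before and after
  exchanging the colors \<open>a\<close>, \<open>b\<close> of \<open>qz\<close>, \<open>qz'\<close>. The critical cycles in the colors \<open>a\<close>
  and \<open>\<delta>\<close> then share \<open>qx\<close>, and one reaches \<open>q\<close> through \<open>z\<close>, the other through \<open>z'\<close>.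
  The common coloring \<open>f\<close> for \<open>leafless_share_edge\<close> gives color \<open>a\<close> to both \<open>qz\<close> and \<open>qz'\<close>.\<close>

lemma second_inner_neighbor:
  assumes x: "x \<in> X" "{q, x} \<in> E" and g: "good (E - {{q, x}}) C c"
    and unext: "\<And>c'. \<not> good E C c'"
    and T: "\<And>x z. x \<in> X \<Longrightarrow> z \<in> outer E q X \<Longrightarrow> {x, z} \<notin> E"
  shows "\<exists>x'\<in>X. x' \<noteq> x \<and> {q, x'} \<in> E"
proof (rule ccontr)
  assume n: "\<not> ?thesis"
  let ?R = "outer E q X"
  have A: "E - (\<lambda>u. {q, u}) ` X = E - {{q, x}}" using n x(1) by auto
  note gA = g[folded A]
  obtain y where s: "stuck E C c q x y ?R" using stuck_all_colors[OF x g] unext by auto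
  obtain z z' where R: "?R = {z, z'}" "z \<noteq> z'" using stuckD(4)[OF s] unfolding card_2_iff by blast
  have zR: "z \<in> ?R" "z' \<in> ?R" using R by auto
  let ?a = "c {q, z}" and ?b = "c {q, z'}"
  define c1 where "c1 = c({q, z} := ?b, {q, z'} := ?a)"
  have neq: "{q, z} \<noteq> {q, z'}" using R(2) by (auto simp: doubleton_eq_iff)
  have c1q: "c1 {q, z} = ?b" "c1 {q, z'} = ?a" unfolding c1_def using neq by auto
  have g1: "good (E - {{q, x}}) C c1"
    unfolding c1_def A[symmetric] by (rule swap_outer_colors[OF gA unext T R])
  obtain y1 where s1': "stuck E C c1 q x y1 ?R" using stuck_all_colors[OF x g1] unext by auto
  have qx: "q \<noteq> x" using no_loop x(2) by blast
  have "y1 = y" using stuckD(3)[OF s stuckD(1)[OF s1']] stuckD(2)[OF s1'] qx by (auto simp: doubleton_eq_iff)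
  then have s1: "stuck E C c1 q x y ?R" using s1' by simp
  have at_q: "e = {q, z} \<or> e = {q, z'}" if e: "e \<in> E - {{q, x}}" "q \<in> e" for e
    by (rule star_complement_edgeE[OF e[folded A]]) (use R in auto)
  have qzA: "{q, z} \<in> E - {{q, x}}" "{q, z'} \<in> E - {{q, x}}"
    using outer_edge_in_star_complement[of z] outer_edge_in_star_complement[of z'] zR unfolding A by blast+
  have "{e \<in> E - {{q, x}}. q \<in> e} = {{q, z}, {q, z'}}" using at_q qzA by auto
  then have free: "free_colors (E - {{q, x}}) C c1 q = free_colors (E - {{q, x}}) C c q"
    unfolding free_colors_def using c1q by auto
  have "2 \<le> card (free_colors (E - {{q, x}}) C c q)" by (rule card_free_ge_2) (use x(2) in auto)
  then have "free_colors (E - {{q, x}}) C c q \<noteq> {}" by auto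
  then obtain \<delta> where \<delta>: "\<delta> \<in> free_colors (E - {{q, x}}) C c q" by blast
  note \<delta>1 = \<delta>[folded free]
  obtain F where F: "critical E c q x y z \<delta> F" using stuckD(8)[OF s zR(1) \<delta>] by blast
  obtain F' where F': "critical E c1 q x y z' \<delta> F'" using stuckD(8)[OF s1 zR(2) \<delta>1] by blast
  note Fq = critical_at_pivot[OF good_proper[OF g] F \<delta> stuckD(5)[OF s zR(1)] qx stuckD(2)[OF s]]
  note F'q = critical_at_pivot[OF good_proper[OF g1] F' \<delta>1 stuckD(5)[OF s zR(2)] qx stuckD(2)[OF s]]
  have colz': "c ` {e \<in> E. z' \<in> e} = C - {?a}"
    using saturated[OF gA unext T zR(2)] R by (auto simp: doubleton_eq_iff)
  have zn: "z \<noteq> x" "z' \<noteq> x" using stuckD(5)[OF s] zR by auto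
  have zq: "z \<noteq> q" "z' \<noteq> q" using no_loop qzA by blast+
  have xyE: "{x, y} \<in> E" using stuckD(1)[OF s] .
  have z'y: "z' \<noteq> y" using T[OF x(1) zR(2)] xyE by auto
  define c2 where "c2 = c({x, y} := ?a, {q, x} := \<delta>)"
  define f where "f = c2({q, z'} := ?a)"
  have p2: "proper_edge_coloring E C c2" unfolding c2_def
    by (rule stuck_coloring_proper[OF s g qx zR(1) \<delta>])
  have qx_neq: "{q, x} \<noteq> {q, z}" "{q, x} \<noteq> {q, z'}" using zn by (auto simp: doubleton_eq_iff)
  have "{q, z'} \<notin> F" "{q, z} \<notin> F'"
  proof -
    have "{q, z'} \<notin> {h \<in> F. q \<in> h}" unfolding Fq using neq qx_neq by auto
    then show "{q, z'} \<notin> F" by simp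
    have "{q, z} \<notin> {h \<in> F'. q \<in> h}" unfolding F'q using neq qx_neq by auto
    then show "{q, z} \<notin> F'" by simp
  qed
  have fF: "f e \<in> {?a, \<delta>}" if "e \<in> F" for e
  proof -
    have "e \<noteq> {q, z'}" using that \<open>{q, z'} \<notin> F\<close> by blast
    then have "f e = c2 e" unfolding f_def by simp
    then show ?thesis using criticalD(6)[OF F that] unfolding c2_def by simp
  qed
  have fF': "f e \<in> {?a, \<delta>}" if "e \<in> F'" for e
  proof (cases "e = {q, z'}")
    case True
    then show ?thesis unfolding f_def by simp
  next
    case False
    have "e \<noteq> {q, z}" using that \<open>{q, z} \<notin> F'\<close> by blast
    then have "c1 e = c e" using False unfolding c1_def by simp
    then have "f e = (c1({x, y} := c1 {q, z'}, {q, x} := \<delta>)) e"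
      using False unfolding f_def c2_def c1q by simp
    then show ?thesis using criticalD(6)[OF F' that] unfolding c1q by simp
  qed
  have z'_edge: "f e \<noteq> ?a" if e: "e \<in> E" "z' \<in> e" "e \<noteq> {q, z'}" for e
  proof -
    have "e \<noteq> {q, x}" "e \<noteq> {x, y}" using e(2) zq zn z'y by auto
    then have "f e = c e" unfolding f_def c2_def using e(3) by simp
    moreover have "c e \<in> C - {?a}" unfolding colz'[symmetric] using e by blast
    ultimately show ?thesis by simp
  qed
  have f_qz': "f {q, z'} = ?a" unfolding f_def by simp
  have FE: "F \<subseteq> E" "F' \<subseteq> E" using criticalD(1)[OF F] criticalD(1)[OF F'] .
  show False
  proof (rule leafless_share_edge[where F = F and F' = F' and g = f and q = q and s = "{q, x}" and t = "{q, z}"])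
    show "finite F" using FE(1) finite_E by (rule finite_subset)
    show "card e = 2" if "e \<in> F" for e using that FE(1) card_edge by blast
    show "leafless F" "leafless F'" using criticalD(2)[OF F] criticalD(2)[OF F'] .
    show "f ` F \<subseteq> {?a, \<delta>}" "f ` F' \<subseteq> {?a, \<delta>}" using fF fF' by blast+
    show "{h \<in> F. q \<in> h} = {{q, x}, {q, z}}" unfolding Fq by blast
    show "{q, x} \<in> F'" using criticalD(3)[OF F'] .
    show "{q, z} \<notin> F'" by fact
    show "f e \<noteq> f e'" if v: "v \<noteq> q" and e: "e \<in> F \<union> F'" "e' \<in> F \<union> F'" "v \<in> e" "v \<in> e'" "e \<noteq> e'" for v e e'
    proof -
      have E: "e \<in> E" "e' \<in> E" using e(1,2) FE by blast+
      consider "e = {q, z'}" | "e' = {q, z'}" | "e \<noteq> {q, z'}" "e' \<noteq> {q, z'}" by blast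
      then show ?thesis
      proof cases
        case 1
        then have "v = z'" using v e(3) by blast
        then show ?thesis using z'_edge[OF E(2)] e(4,5) 1 f_qz' by metis
      next
        case 2
        then have "v = z'" using v e(4) by blast
        then show ?thesis using z'_edge[OF E(1)] e(3,5) 2 f_qz' by metis
      next
        case 3
        then have "f e = c2 e" "f e' = c2 e'" unfolding f_def by auto
        then show ?thesis using proper_inj[OF p2 E e(3,4)] e(5) by auto
      qed
    qed
  qed
qed

end

section \<open>Minimal counterexamples\<close>

lemma nbrs_degree:
  assumes "\<And>e. e \<in> E \<Longrightarrow> card e = 2"
  shows "degree E v = card {u. {v, u} \<in> E}"
proof -
  have "bij_betw (\<lambda>u. {v, u}) {u. {v, u} \<in> E} {e \<in> E. v \<in> e}"
  proof (rule bij_betwI')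
    show "{v, u} = {v, w} \<longleftrightarrow> u = w" for u w by (auto simp: doubleton_eq_iff)
    show "\<exists>u\<in>{u. {v, u} \<in> E}. e = {v, u}" if "e \<in> {e \<in> E. v \<in> e}" for e
    proof -
      have "card e = 2" "v \<in> e" using that assms by auto
      then obtain u where "e = {v, u}" by (rule two_element_edge)
      then show ?thesis using that by blast
    qed
  qed auto
  then show ?thesis unfolding degree_def by (simp add: bij_betw_same_card)
qed

text \<open>A counterexample that is minimal under the removal of edges; these assumptions turn out to be
  contradictory (\<open>no_minimal_counterexample\<close>).\<close>

locale uncolorable = finite_simple_graph V E for V :: "'a set" and E +
  fixes C :: "'c set"
  assumes deg: "degenerate 2 V E" and fin_C: "finite C" and deg_less: "degree E v < card C"
    and uncol: "\<not> good E C c"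
    and sub_col: "e \<in> E \<Longrightarrow> \<exists>c. good (E - {e}) C c"
begin

definition inner :: "'a \<Rightarrow> 'a set" where
  "inner v = {u. {v, u} \<in> E \<and> degree E u \<le> 2}"

abbreviation big :: "'a \<Rightarrow> 'a set" where
  "big v \<equiv> outer E v (inner v)"

abbreviation light :: "'a \<Rightarrow> bool" where
  "light v \<equiv> card (big v) \<le> 2"

lemma card_e: "e \<in> E \<Longrightarrow> card e = 2"
  using edges by blast

lemma edge_V: "{u, v} \<in> E \<Longrightarrow> u \<in> V \<and> v \<in> V \<and> u \<noteq> v"
  using edges[of "{u, v}"] by (auto simp: card_2_iff doubleton_eq_iff)

lemma big_iff: "u \<in> big v \<longleftrightarrow> {v, u} \<in> E \<and> 2 < degree E u"
  unfolding outer_def inner_def by auto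

lemma inner_iff: "u \<in> inner v \<longleftrightarrow> {v, u} \<in> E \<and> degree E u \<le> 2"
  unfolding inner_def by auto

lemma pivotI:
  assumes "light v"
  shows "pivot E C v (inner v)"
proof
  show "v \<notin> inner v" using edge_V[of v v] inner_iff[of v v] by blast
qed (use assms finite_E card_e fin_C deg_less inner_iff in auto)

lemma finite_nbrs: "finite {u. {v, u} \<in> E}"
proof (rule finite_subset)
  show "{u. {v, u} \<in> E} \<subseteq> V" using edge_V by blast
qed (rule finite_V)

lemma degree_split: "degree E v = card (big v) + card (inner v)"
proof -
  have "{u. {v, u} \<in> E} = big v \<union> inner v" using big_iff inner_iff by auto
  moreover have "big v \<inter> inner v = {}" using big_iff inner_iff by auto
  moreover have "finite (big v)" "finite (inner v)"
    using finite_nbrs[of v] calculation(1) by (metis finite_Un)+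
  ultimately show ?thesis using nbrs_degree[of E v] card_e by (simp add: card_Un_disjoint)
qed

text \<open>Minimality makes every inner neighbor of a light vertex stuck in some coloring, so
  \<open>stuck_neighbor_not_outer\<close> applies to each of them.\<close>

lemma inner_not_adjacent_big:
  assumes v: "light v" and x: "x \<in> inner v" and z: "z \<in> big v"
  shows "{x, z} \<notin> E"
proof -
  interpret pivot E C v "inner v" by (rule pivotI[OF v])
  have vx: "{v, x} \<in> E" using x inner_iff by blast
  obtain c where g: "good (E - {{v, x}}) C c" using sub_col[OF vx] by blast
  show ?thesis by (rule stuck_neighbor_not_outer[OF x vx g uncol z])
qed

lemma star_colorable:
  assumes "x \<in> inner v"
  shows "\<exists>c. good (E - (\<lambda>u. {v, u}) ` inner v) C c"
proof -
  have "{v, x} \<in> E" using assms inner_iff by blast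
  then obtain c where g: "good (E - {{v, x}}) C c" using sub_col by blast
  have "good (E - (\<lambda>u. {v, u}) ` inner v) C c" by (rule good_subset[OF g]) (use assms in blast)
  then show ?thesis by blast
qed

lemma card_big:
  assumes "light v" "x \<in> inner v"
  shows "card (big v) = 2"
proof -
  interpret pivot E C v "inner v" by (rule pivotI[OF assms(1)])
  have vx: "{v, x} \<in> E" using assms(2) inner_iff by blast
  obtain c where g: "good (E - {{v, x}}) C c" using sub_col[OF vx] by blast
  obtain y where "stuck E C c v x y (big v)" using stuck_all_colors[OF assms(2) vx g uncol] by blast
  then show ?thesis by (rule stuckD(4))
qed

lemma light_saturated:
  assumes v: "light v" and g: "good (E - (\<lambda>u. {v, u}) ` inner v) C c" and z: "z \<in> big v"
  obtains z' where "z' \<noteq> z" "big v = {z, z'}" "c ` {e \<in> E. z \<in> e} = C - {c {v, z'}}"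
proof -
  interpret pivot E C v "inner v" by (rule pivotI[OF v])
  show ?thesis
    using saturated[OF g uncol inner_not_adjacent_big[OF v] z] that by auto
qed

lemma degree_big:
  assumes v: "light v" and x: "x \<in> inner v" and z: "z \<in> big v"
  shows "card C \<le> Suc (degree E z)"
proof -
  obtain c where "good (E - (\<lambda>u. {v, u}) ` inner v) C c" using star_colorable[OF x] by blast
  then obtain z' where cols: "c ` {e \<in> E. z \<in> e} = C - {c {v, z'}}"
    by (rule light_saturated[OF v _ z])
  have "card C \<le> Suc (card (C - {c {v, z'}}))"
    by (simp add: card_Diff_singleton_if) linarith
  also have "card (C - {c {v, z'}}) \<le> degree E z"
    unfolding cols[symmetric] degree_def by (rule card_image_le) (use finite_E in simp)
  finally show ?thesis by simp
qed

lemma second_inner: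
  assumes v: "light v" and x: "x \<in> inner v"
  shows "2 \<le> card (inner v)"
proof -
  interpret pivot E C v "inner v" by (rule pivotI[OF v])
  have vx: "{v, x} \<in> E" using x inner_iff by blast
  obtain c where g: "good (E - {{v, x}}) C c" using sub_col[OF vx] by blast
  obtain x' where x': "x' \<in> inner v" "x' \<noteq> x"
    using second_inner_neighbor[OF x vx g uncol inner_not_adjacent_big[OF v]] by blast
  have "finite (inner v)" by (rule finite_subset[OF _ finite_nbrs[of v]]) (use inner_iff in auto)
  then have "card {x, x'} \<le> card (inner v)" by (rule card_mono) (use x x' in blast)
  then show ?thesis using x'(2) by simp
qed

lemma few_neighbors_inside:
  assumes S: "S \<subseteq> V" "S \<noteq> {}"
  shows "\<exists>v\<in>S. card {u \<in> S. {v, u} \<in> E} \<le> 2"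
proof -
  obtain v where v: "v \<in> S" "degree (induced_edges E S) v \<le> 2"
    using deg S unfolding degenerate_def by blast
  have "degree (induced_edges E S) v = card {u. {v, u} \<in> induced_edges E S}"
    by (rule nbrs_degree) (use card_e in \<open>auto simp: induced_edges_def\<close>)
  also have "{u. {v, u} \<in> induced_edges E S} = {u \<in> S. {v, u} \<in> E}"
    using v(1) unfolding induced_edges_def by auto
  finally show ?thesis using v by auto
qed

text \<open>Apply degeneracy to the vertices of degree above 2 that are not light. The
  resulting \<open>p\<close> has more than two big neighbors, of which at most two are not light. If there are
  no such vertices, a light vertex of degree above 2, which exists by degeneracy, and one of its big
  neighbors will do.\<close>

lemma pivot_pair:
  "\<exists>p q. p \<in> big q \<and> q \<in> big p \<and> light q \<and> card {u \<in> big p. \<not> light u} \<le> 2"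
proof -
  let ?R1 = "{v \<in> V. 2 < degree E v}"
  have bigR1: "big v = {u \<in> ?R1. {v, u} \<in> E}" for v using big_iff edge_V by auto
  have "E \<noteq> {}" using uncol[of undefined] unfolding good_def proper_edge_coloring_def by auto
  then obtain e where e: "e \<in> E" by blast
  then obtain u v where uv: "e = {u, v}" using card_e unfolding card_2_iff by blast
  have "?R1 \<noteq> {}"
  proof
    assume n: "?R1 = {}"
    have "big u = {}" unfolding bigR1 n by simp
    moreover have "v \<in> inner u" using n uv e edge_V inner_iff by (auto simp: not_less)
    ultimately show False using card_big[of u v] by simp
  qed
  then obtain v0 where v0: "v0 \<in> ?R1" "card {u \<in> ?R1. {v0, u} \<in> E} \<le> 2"
    using few_neighbors_inside[of ?R1] by auto
  then have l0: "light v0" unfolding bigR1 by simp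
  let ?R2 = "{v \<in> ?R1. \<not> light v}"
  show ?thesis
  proof (cases "?R2 = {}")
    case True
    have "inner v0 \<noteq> {}" using degree_split[of v0] v0(1) l0 by auto
    then obtain x where "x \<in> inner v0" by blast
    then have "big v0 \<noteq> {}" using card_big[OF l0] by auto
    then obtain p where p: "p \<in> big v0" by blast
    have none: "{u \<in> big p. \<not> light u} = {}" using True bigR1[of p] by blast
    have "v0 \<in> big p" using p v0(1) unfolding big_iff by (auto simp: insert_commute)
    then show ?thesis using p l0 by (intro exI[of _ p] exI[of _ v0] conjI) (simp_all only: none card.empty)
  next
    case False
    then obtain p where p: "p \<in> ?R2" "card {u \<in> ?R2. {p, u} \<in> E} \<le> 2"
      using few_neighbors_inside[of ?R2] by auto
    have eq: "{u \<in> ?R2. {p, u} \<in> E} = {u \<in> big p. \<not> light u}" unfolding bigR1[of p] by blast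
    have "\<not> big p \<subseteq> {u \<in> big p. \<not> light u}"
    proof
      assume "big p \<subseteq> {u \<in> big p. \<not> light u}"
      then have "big p = {u \<in> big p. \<not> light u}" by blast
      then have "light p" using p(2) unfolding eq by simp
      then show False using p(1) by blast
    qed
    then obtain q where q: "q \<in> big p" "light q" by blast
    have "p \<in> big q" using q(1) p(1) unfolding big_iff by (auto simp: insert_commute)
    then show ?thesis using p(2) q unfolding eq by blast
  qed
qed

text \<open>Since \<open>q\<close> has two big and at least two inner neighbors, \<open>\<Delta> \<ge> 4\<close>. As \<open>p\<close> has degree
  \<open>\<Delta>\<close> and at most two neighbors that are not light, \<open>q\<close> is not its only light neighbor.\<close>

lemma two_pivots:
  "\<exists>p q w. p \<in> big q \<and> q \<in> big p \<and> light q \<and> light w \<and> {p, w} \<in> E \<and> w \<noteq> q \<and> inner q \<noteq> {} \<and> 5 \<le> card C"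
proof -
  obtain p q where pq: "p \<in> big q" "q \<in> big p" "light q" "card {u \<in> big p. \<not> light u} \<le> 2"
    using pivot_pair by blast
  have "2 < degree E q" using pq(2) big_iff by blast
  then have "inner q \<noteq> {}" using degree_split[of q] pq(3) by auto
  then obtain x where x: "x \<in> inner q" by blast
  have "4 \<le> degree E q" using degree_split[of q] card_big[OF pq(3) x] second_inner[OF pq(3) x] by simp
  then have C5: "5 \<le> card C" using deg_less[of q] by simp
  then have d4: "4 \<le> degree E p" using degree_big[OF pq(3) x pq(1)] by simp
  let ?N = "{u. {p, u} \<in> E}"
  have light: "light u" if "u \<in> ?N" "u \<notin> {u \<in> big p. \<not> light u}" for u
  proof (cases "2 < degree E u")
    case True
    then show ?thesis using that big_iff by auto
  next
    case False
    then show ?thesis using degree_split[of u] by simp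
  qed
  have "\<not> ?N \<subseteq> insert q {u \<in> big p. \<not> light u}"
  proof
    assume sub: "?N \<subseteq> insert q {u \<in> big p. \<not> light u}"
    have "finite {u \<in> big p. \<not> light u}" by (rule finite_subset[OF _ finite_nbrs[of p]]) (use big_iff in auto)
    then have "card ?N \<le> card (insert q {u \<in> big p. \<not> light u})" using sub by (intro card_mono) auto
    also have "\<dots> \<le> Suc (card {u \<in> big p. \<not> light u})" by (rule card_insert_le_m1) simp_all
    finally show False using d4 pq(4) nbrs_degree[of E p] card_e by simp
  qed
  then obtain w where "w \<in> ?N" "w \<noteq> q" "w \<notin> {u \<in> big p. \<not> light u}" by blast
  then show ?thesis using pq x C5 light by blast
qed

end

context uncolorable
begin

text \<open>Here \<open>G\<close> is the graph without the edges from \<open>w\<close> to its inner neighbors, and \<open>H\<close> also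
  lacks those from \<open>q\<close> to its inner neighbors. A coloring of \<open>H\<close> is extended first to \<open>G\<close> by
  means of the pivot \<open>q\<close>, then to \<open>E\<close> by means of \<open>w\<close>. None of these steps changes an edge
  at \<open>p\<close> or an edge from \<open>q\<close> or \<open>w\<close> to a big neighbor.\<close>

lemma no_minimal_counterexample: False
proof -
  obtain p q w where pq: "p \<in> big q" "q \<in> big p" and lq: "light q" and lw: "light w"
    and pw: "{p, w} \<in> E" and wq: "w \<noteq> q" and iq: "inner q \<noteq> {}" and C5: "5 \<le> card C"
    using two_pivots by blast
  let ?star = "\<lambda>v. (\<lambda>u. {v, u}) ` inner v"
  let ?G = "E - ?star w"
  let ?H = "?G - ?star q"
  interpret Q: pivot E C q "inner q" by (rule pivotI[OF lq])
  interpret W: pivot E C w "inner w" by (rule pivotI[OF lw])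
  interpret G: pivot ?G C q "inner q" by (rule Q.pivot_subset) blast
  have degp: "2 < degree E p" and degq: "2 < degree E q" using pq big_iff by blast+
  have pw': "{w, p} \<in> E" using pw by (simp add: insert_commute)
  have pbw: "p \<in> big w" using pw' degp big_iff by blast
  have pq': "{q, p} \<in> E" using pq(1) big_iff by blast
  have w_inner: "w \<notin> inner q" using inner_not_adjacent_big[OF lq _ pq(1)] pw' by blast
  have q_inner: "q \<notin> inner w" "q \<notin> inner q" "w \<notin> inner w" "p \<notin> inner q" "p \<notin> inner w"
    using degq degp Q.pivot_notin W.pivot_notin inner_iff by auto
  have np: "p \<noteq> q" "p \<noteq> w" using edge_V pq' pw by blast+
  have big_inner: "z \<notin> inner u" if "z \<in> big v" for z u v using that big_iff inner_iff by auto
  have at_p: "e \<inter> inner q = {} \<and> e \<inter> inner w = {}" if "e \<in> E" "p \<in> e" for e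
    using Q.edge_at_outer_avoids[OF inner_not_adjacent_big[OF lq] pq(1) that]
      W.edge_at_outer_avoids[OF inner_not_adjacent_big[OF lw] pbw that] by blast
  have at_q: "{q, z} \<inter> inner q = {}" "{q, z} \<inter> inner w = {}" if "z \<in> big q" for z
    using big_inner[OF that] q_inner by auto
  have at_w: "{w, z} \<inter> inner q = {}" "{w, z} \<inter> inner w = {}" if "z \<in> big w" for z
    using big_inner[OF that] q_inner w_inner by auto
  have inG: "e \<in> ?G" if "e \<in> E" "e \<inter> inner w = {}" for e
    using that by auto
  have inH: "e \<in> ?H" if "e \<in> E" "e \<inter> inner w = {}" "e \<inter> inner q = {}" for e
    using that by auto
  have pG: "{e \<in> ?G. p \<in> e} = {e \<in> E. p \<in> e}" using at_p inG by blast
  have outerG: "outer ?G q (inner q) = big q"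
  proof
    show "outer ?G q (inner q) \<subseteq> big q" unfolding outer_def by blast
    show "big q \<subseteq> outer ?G q (inner q)"
    proof
      fix z assume z: "z \<in> big q"
      then have "{q, z} \<in> E" using big_iff by blast
      then have "{q, z} \<in> ?G" using inG at_q[OF z] by blast
      then show "z \<in> outer ?G q (inner q)" using big_inner[OF z] unfolding outer_def by simp
    qed
  qed
  have TG: "{x, z} \<notin> ?G" if "x \<in> inner q" "z \<in> outer ?G q (inner q)" for x z
    using inner_not_adjacent_big[OF lq that(1), of z] that(2) unfolding outerG by blast
  have pG': "p \<in> outer ?G q (inner q)" unfolding outerG by (rule pq(1))

  \<comment> \<open>If the edges from \<open>w\<close> to its inner neighbors cannot be colored, then \<open>p\<close> misses the color of \<open>wr\<close>.\<close>
  have step_w: "\<exists>r\<in>big w. r \<noteq> p \<and> big w = {p, r} \<and> c ` {e \<in> E. p \<in> e} = C - {c {w, r}}"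
    if g: "good ?G C c" for c
  proof -
    obtain r where "r \<noteq> p" "big w = {p, r}" "c ` {e \<in> E. p \<in> e} = C - {c {w, r}}"
      by (rule light_saturated[OF lw g pbw])
    then show ?thesis by (intro bexI[of _ r]) simp_all
  qed
  \<comment> \<open>If \<open>p\<close> sees the colors of \<open>qz\<close> and \<open>wr\<close>, then saturation of \<open>p\<close> is violated at both pivots.\<close>
  have finish: False
    if g: "good ?H C c" and rq: "\<And>z. z \<in> big q \<Longrightarrow> z \<noteq> p \<Longrightarrow> c {q, z} \<in> c ` {e \<in> E. p \<in> e}"
      and rw: "\<And>z. z \<in> big w \<Longrightarrow> z \<noteq> p \<Longrightarrow> c {w, z} \<in> c ` {e \<in> E. p \<in> e}" for c
  proof -
    have "\<exists>c1. (\<forall>e. e \<inter> inner q = {} \<longrightarrow> c1 e = c e) \<and> good ?G C c1"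
    proof (rule ccontr)
      assume n: "\<not> ?thesis"
      then have unext: "\<not> good ?G C c1" if "\<And>e. e \<inter> inner q = {} \<Longrightarrow> c1 e = c e" for c1
        using that by blast
      obtain z where z: "z \<noteq> p" "big q = {p, z}" "c ` {e \<in> ?G. p \<in> e} = C - {c {q, z}}"
        using G.saturated[OF g unext TG pG'] unfolding outerG by auto
      show False using rq[of z] z unfolding pG by blast
    qed
    then obtain c1 where ag: "\<forall>e. e \<inter> inner q = {} \<longrightarrow> c1 e = c e" and g1: "good ?G C c1" by blast
    obtain r where r: "r \<in> big w" "r \<noteq> p" "c1 ` {e \<in> E. p \<in> e} = C - {c1 {w, r}}"
      using step_w[OF g1] by blast
    have "c1 ` {e \<in> E. p \<in> e} = c ` {e \<in> E. p \<in> e}" using ag at_p by (intro image_cong) auto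
    moreover have "c1 {w, r} = c {w, r}" using ag at_w[OF r(1)] by blast
    ultimately have "c ` {e \<in> E. p \<in> e} = C - {c {w, r}}" using r(3) by simp
    then show False using rw[OF r(1,2)] by blast
  qed

  \<comment> \<open>No edge from \<open>w\<close> to a big neighbor has the color of \<open>qp\<close>, possibly after exchanging the
      colors of \<open>qp\<close> and \<open>qz\<close>.\<close>
  have "\<exists>c. good (E - ?star q) C c \<and> (\<forall>r\<in>big w. c {w, r} \<noteq> c {q, p})"
  proof -
    obtain c where g: "good (E - ?star q) C c" using star_colorable iq by blast
    obtain z where z: "z \<noteq> p" "big q = {p, z}" "c ` {e \<in> E. p \<in> e} = C - {c {q, z}}"
      by (rule light_saturated[OF lq g pq(1)])
    show ?thesis
    proof (cases "\<forall>r\<in>big w. c {w, r} \<noteq> c {q, p}")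
      case True
      then show ?thesis using g by blast
    next
      case False
      then obtain r where r: "r \<in> big w" "c {w, r} = c {q, p}" by blast
      let ?c = "c({q, p} := c {q, z}, {q, z} := c {q, p})"
      have g': "good (E - ?star q) C ?c"
        by (rule Q.swap_outer_colors[OF g uncol inner_not_adjacent_big[OF lq] z(2) z(1)[symmetric]])
      have neq: "{q, p} \<noteq> {q, z}" using z(1) by (auto simp: doubleton_eq_iff)
      have qA: "{q, p} \<in> E - ?star q" "{q, z} \<in> E - ?star q"
        using Q.outer_edge_in_star_complement z(2) by blast+
      have wA: "{w, p} \<in> E - ?star q" using pw' at_p by auto
      note pr = good_proper[OF g]
      have ab: "c {q, p} \<noteq> c {q, z}" using proper_inj[OF pr qA, of q] neq by auto
      have wpq: "{w, p} \<noteq> {q, p}" using wq by (auto simp: doubleton_eq_iff)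
      have "c {w, p} \<noteq> c {q, p}" using proper_inj[OF pr wA qA(1), of p] wpq by auto
      then have "r \<noteq> p" using r(2) by auto
      have bw: "big w = {p, r}"
      proof (rule card_seteq[symmetric])
        show "finite (big w)" by (rule W.finite_outer)
        show "{p, r} \<subseteq> big w" using pbw r(1) by blast
        show "card (big w) \<le> card {p, r}" using lw \<open>r \<noteq> p\<close> by simp
      qed
      have "c {w, p} \<in> C - {c {q, z}}" unfolding z(3)[symmetric] using pw' by blast
      then have wp: "c {w, p} \<noteq> c {q, z}" by blast
      have notqp: "{w, r'} \<noteq> {q, p}" for r' using wq np by (auto simp: doubleton_eq_iff)
      have "?c {w, r'} \<noteq> ?c {q, p}" if "r' \<in> big w" for r'
      proof (cases "{w, r'} = {q, z}")
        case True
        then show ?thesis using ab neq by simp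
      next
        case False
        then have "?c {w, r'} = c {w, r'}" using notqp by simp
        moreover have "c {w, r'} \<noteq> c {q, z}" using that wp r(2) ab unfolding bw by auto
        ultimately show ?thesis using neq by simp
      qed
      then show ?thesis using g' by blast
    qed
  qed
  then obtain c where g: "good (E - ?star q) C c" and no_a: "\<And>r. r \<in> big w \<Longrightarrow> c {w, r} \<noteq> c {q, p}"
    by blast
  note pr = good_proper[OF g]
  obtain z where z: "z \<noteq> p" "big q = {p, z}" and colp: "c ` {e \<in> E. p \<in> e} = C - {c {q, z}}"
    by (rule light_saturated[OF lq g pq(1)])
  have zb: "z \<in> big q" using z(2) by blast
  have colz: "c ` {e \<in> E. z \<in> e} = C - {c {q, p}}"
    using light_saturated[OF lq g zb] z by (metis doubleton_eq_iff)
  have gH: "good ?H C c" by (rule good_subset[OF g]) blast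
  note prH = good_proper[OF gH]

  \<comment> \<open>In \<open>G\<close> the pivot \<open>q\<close> is not stuck: that would require an edge at \<open>w\<close> with the color of
      \<open>qp\<close>, but only the edges from \<open>w\<close> to big neighbors are left there.\<close>
  have "\<exists>c1. (\<forall>e. e \<inter> inner q = {} \<longrightarrow> c1 e = c e) \<and> good ?G C c1"
  proof (rule ccontr)
    assume n: "\<not> ?thesis"
    then have unext: "\<not> good ?G C c1" if "\<And>e. e \<inter> inner q = {} \<Longrightarrow> c1 e = c e" for c1
      using that by blast
    have "{p, w} \<in> ?G" using inG[OF pw] at_p[OF pw] by simp
    then have pw_G: "{p, w} \<in> ?G \<and> w \<noteq> q" using wq by (rule conjI)
    have "\<forall>w. {p, w} \<in> ?G \<and> w \<noteq> q \<longrightarrow>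
        (\<exists>h\<in>?G. w \<in> h \<and> h \<noteq> {p, w} \<and> (h \<inter> inner q = {} \<longrightarrow> c h = c {q, p}))"
    proof (rule exE[OF G.saturated[OF gH]])
      show "\<not> good ?G C c1" if "\<And>e. e \<inter> inner q = {} \<Longrightarrow> c1 e = c e" for c1
        by (rule unext[OF that])
      show "{x, z} \<notin> ?G" if "x \<in> inner q" "z \<in> outer ?G q (inner q)" for x z
        by (rule TG[OF that])
      show "p \<in> outer ?G q (inner q)" by (rule pG')
    qed (elim conjE; assumption)
    from this[rule_format, OF pw_G]
    obtain h where h: "h \<in> ?G" "w \<in> h" "h \<noteq> {p, w}" "h \<inter> inner q = {} \<longrightarrow> c h = c {q, p}"
      by (elim bexE conjE)
    have "h \<in> E" using h(1) by blast
    from card_e[OF this] h(2) obtain u where u: "h = {w, u}" by (rule two_element_edge)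
    have "u \<notin> inner w" using h(1) u by blast
    then have ubw: "u \<in> big w" using h(1) u inner_iff[of u w] big_iff[of u w] by auto
    show False using h(4) at_w(1)[OF ubw] no_a[OF ubw] unfolding u by simp
  qed
  then obtain c1 where ag: "\<forall>e. e \<inter> inner q = {} \<longrightarrow> c1 e = c e" and g1: "good ?G C c1" by blast
  obtain r where r: "r \<in> big w" "r \<noteq> p" "big w = {p, r}" "c1 ` {e \<in> E. p \<in> e} = C - {c1 {w, r}}"
    using step_w[OF g1] by blast
  \<comment> \<open>Hence \<open>w\<close> is stuck, and the color of \<open>wr\<close> is the one missing at \<open>p\<close>, like that of \<open>qz\<close>.\<close>
  have "c1 ` {e \<in> E. p \<in> e} = c ` {e \<in> E. p \<in> e}" using ag at_p by (intro image_cong) auto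
  moreover have "c1 {w, r} = c {w, r}" using ag at_w[OF r(1)] by blast
  ultimately have eq: "C - {c {q, z}} = C - {c {w, r}}" using r(4) colp by simp

  have qpE: "{q, p} \<in> E" "{q, z} \<in> E" "{w, p} \<in> E" "{w, r} \<in> E"
    using pq(1) zb pbw r(1) big_iff by blast+
  have H: "{q, p} \<in> ?H" "{q, z} \<in> ?H" "{w, p} \<in> ?H" "{w, r} \<in> ?H"
    using inH qpE at_q[OF pq(1)] at_q[OF zb] at_w[OF pbw] at_w[OF r(1)] by blast+
  have inC: "c e \<in> C" if "e \<in> ?H" for e
    using prH that unfolding proper_edge_coloring_def by blast
  define a where "a = c {q, p}"
  define b where "b = c {q, z}"
  have rb: "c {w, r} = b" using eq inC[OF H(4)] unfolding b_def by blast
  have H_at_q: "e = {q, p} \<or> e = {q, z}" if "e \<in> ?H" "q \<in> e" for e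
    by (rule Q.star_complement_edgeE[of e]) (use that z(2) in auto)
  have H_at_w: "e = {w, p} \<or> e = {w, r}" if "e \<in> ?H" "w \<in> e" for e
    by (rule W.star_complement_edgeE[of e]) (use that r(3) in auto)
  have inj: "e = f" if "e \<in> ?H" "f \<in> ?H" "v \<in> e" "v \<in> f" "c e = c f" for e f v
    by (rule proper_inj[OF prH that])
  have ne1: "{q, p} \<noteq> {q, z}" "{w, p} \<noteq> {w, r}" "{w, p} \<noteq> {q, p}" "{q, p} \<noteq> {w, r}" "{q, z} \<noteq> {w, p}"
    using z(1) r(2) wq np by (auto simp: doubleton_eq_iff)
  have ab: "a \<noteq> b" using inj[OF H(1,2), of q] ne1(1) unfolding a_def b_def by auto
  have p_not_b: "c e \<noteq> b" if "e \<in> E" "p \<in> e" for e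
  proof -
    have "c e \<in> C - {b}" using that colp unfolding b_def by blast
    then show ?thesis by blast
  qed
  have wp_a: "c {w, p} \<noteq> a" using inj[OF H(3,1), of p] ne1(3) unfolding a_def by auto
  have zq: "z \<noteq> q" "r \<noteq> w" using edge_V qpE by blast+
  show False
  proof (cases "{w, r} = {q, z}")
    case True
    \<comment> \<open>Now \<open>p\<close>, \<open>q\<close>, \<open>w\<close> form a triangle, and in \<open>H\<close> the vertices \<open>q\<close> and \<open>w\<close> have degree 2. With
        three colors on the triangle, any color that \<open>p\<close> sees elsewhere is possible for \<open>qw\<close>.\<close>
    then have tri: "r = q" "z = w" using wq by (auto simp: doubleton_eq_iff)
    let ?g = "c {w, p}"
    have "\<not> C \<subseteq> {a, b, ?g}"
    proof
      assume "C \<subseteq> {a, b, ?g}"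
      then have "card C \<le> card {a, b, ?g}" by (intro card_mono) auto
      also have "\<dots> \<le> 3" by (simp add: card_insert_if)
      finally show False using C5 by simp
    qed
    then obtain d where d: "d \<in> C" "d \<noteq> a" "d \<noteq> b" "d \<noteq> ?g" by blast
    let ?c = "c({q, w} := d)"
    have qw: "{q, w} \<in> ?H" using H(2) tri by simp
    have same: "?c {q, p} = a" "?c {w, p} = ?g" "?c {q, w} = d"
      using ne1 tri unfolding a_def by auto
    have "good ?H C ?c"
    proof (rule good_recolor[OF gH, where T = "{{q, w}}"])
      show "?c e \<noteq> ?c f" if e: "e \<in> {{q, w}}" and f: "f \<in> ?H" "e \<noteq> f" "v \<in> e" "v \<in> f" for e f v
      proof -
        have "q \<in> f \<or> w \<in> f" using e f by auto
        then have "f = {q, p} \<or> f = {w, p}" using H_at_q[of f] H_at_w[of f] f(1,2) e tri by auto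
        then show ?thesis using e same d by auto
      qed
      show "F \<inter> {{q, w}} = {}" if F: "F \<subseteq> ?H" "leafless F" "?c ` F \<subseteq> {\<alpha>, \<beta>}" for F \<alpha> \<beta>
      proof (rule ccontr)
        assume "F \<inter> {{q, w}} \<noteq> {}"
        then have m: "{q, w} \<in> F" by blast
        obtain f where f: "f \<in> F" "f \<noteq> {q, w}" "q \<in> f" by (rule leaflessE[OF F(2) m, of q]) auto
        obtain h where h: "h \<in> F" "h \<noteq> {q, w}" "w \<in> h" by (rule leaflessE[OF F(2) m, of w]) auto
        have "f = {q, p}" using H_at_q[of f] f F(1) tri by auto
        moreover have "h = {w, p}" using H_at_w[of h] h F(1) tri by (auto simp: insert_commute)
        ultimately have "a \<in> {\<alpha>, \<beta>}" "?g \<in> {\<alpha>, \<beta>}" "d \<in> {\<alpha>, \<beta>}"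
          using F(3) f(1) h(1) m same by (metis image_subset_iff)+
        then show False using d wp_a by auto
      qed
    qed (use d(1) in auto)
    then show False
    proof (rule finish)
      have "d \<in> c ` {e \<in> E. p \<in> e}" using colp d unfolding b_def by blast
      then obtain e where e: "e \<in> E" "p \<in> e" "c e = d" by blast
      have "d = ?c e" using e(3) by simp
      then have dp: "d \<in> ?c ` {e \<in> E. p \<in> e}" by (rule image_eqI) (use e in simp)
      show "?c {q, u} \<in> ?c ` {e \<in> E. p \<in> e}" if "u \<in> big q" "u \<noteq> p" for u
      proof -
        have "u = w" using that z(2) tri by simp
        show ?thesis unfolding \<open>u = w\<close> same(3) by (rule dp)
      qed
      show "?c {w, u} \<in> ?c ` {e \<in> E. p \<in> e}" if "u \<in> big w" "u \<noteq> p" for u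
      proof -
        have "{w, u} = {q, w}" using that r(3) tri by (simp add: insert_commute)
        show ?thesis unfolding \<open>{w, u} = {q, w}\<close> same(3) by (rule dp)
      qed
    qed
  next
    case False
    have zw: "z \<noteq> w" "r \<noteq> q"
    proof -
      show "z \<noteq> w"
      proof
        assume zw: "z = w"
        then have "q \<in> big w" using qpE(2) degq big_iff by (simp add: insert_commute)
        then have "r = q" using r(3) np by auto
        then show False using False zw by (auto simp: insert_commute)
      qed
      show "r \<noteq> q"
      proof
        assume rq: "r = q"
        then have "{q, w} \<in> E" using qpE(4) by (simp add: insert_commute)
        then have "w \<in> big q" using w_inner inner_iff[of w q] big_iff[of w q] by auto
        then show False using z(2) np False rq by (auto simp: insert_commute)
      qed
    qed
    \<comment> \<open>A bichromatic cycle through one of the recolored edges contains both edges at \<open>q\<close> or both edges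
        at \<open>w\<close>, so its colors are \<open>a\<close> and \<open>b\<close>. But \<open>z\<close> no longer sees \<open>b\<close>, and at \<open>p\<close> the
        color \<open>b\<close> occurs only on \<open>qp\<close>.\<close>
    define c' where "c' = c({q, p} := b, {q, z} := a, {w, p} := a)"
    have c'v: "c' {q, p} = b" "c' {q, z} = a" "c' {w, p} = a" "c' {w, r} = b"
      unfolding c'_def using ne1 False rb by auto
    have c'o: "c' e = c e" if "e \<notin> {{q, p}, {q, z}, {w, p}}" for e
      using that unfolding c'_def by auto
    have at_z: "c e \<noteq> a \<and> c e \<noteq> b" if "e \<in> ?H" "z \<in> e" "e \<noteq> {q, z}" for e
    proof -
      have "c e \<in> C - {a}" using that(1,2) colz unfolding a_def by blast
      moreover have "c e \<noteq> b" using inj[OF that(1) H(2) that(2)] that(3) unfolding b_def by auto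
      ultimately show ?thesis by blast
    qed
    have at_p': "c e \<noteq> a \<and> c e \<noteq> b" if "e \<in> ?H" "p \<in> e" "e \<noteq> {q, p}" for e
    proof -
      have "c e \<noteq> a" using inj[OF that(1) H(1) that(2)] that(3) unfolding a_def by auto
      then show ?thesis using p_not_b[of e] that(1,2) by blast
    qed
    have C: "a \<in> C" "b \<in> C" using inC H(1,2) unfolding a_def b_def by blast+
    have "good ?H C c'"
    proof (rule good_recolor[OF gH, where T = "{{q, p}, {q, z}, {w, p}}"])
      show "c' e = c e" if "e \<notin> {{q, p}, {q, z}, {w, p}}" for e by (rule c'o[OF that])
      show "c' e \<in> C" if "e \<in> {{q, p}, {q, z}, {w, p}}" for e using that c'v C by auto
      show "c' e \<noteq> c' f"
        if e: "e \<in> {{q, p}, {q, z}, {w, p}}" and f: "f \<in> ?H" "e \<noteq> f" "v \<in> e" "v \<in> f" for e f v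
      proof (cases "q \<in> f \<or> w \<in> f")
        case True
        then have "f = {q, p} \<or> f = {q, z} \<or> f = {w, p} \<or> f = {w, r}"
          using H_at_q[OF f(1)] H_at_w[OF f(1)] by blast
        then show ?thesis using e f(2-4) c'v ab wq np z(1) zw r(2) zq by auto
      next
        case False
        then have "f \<notin> {{q, p}, {q, z}, {w, p}}" by auto
        then have "c' f = c f" by (rule c'o)
        moreover have "v = p \<or> v = z" using e f(3,4) False by auto
        moreover have "f \<noteq> {q, z}" "f \<noteq> {q, p}" using False by auto
        ultimately have "c' f \<noteq> a \<and> c' f \<noteq> b" using at_z[OF f(1)] at_p'[OF f(1)] f(4) by metis
        then show ?thesis using e c'v by auto
      qed
      show "F \<inter> {{q, p}, {q, z}, {w, p}} = {}"
        if F: "F \<subseteq> ?H" "leafless F" "c' ` F \<subseteq> {\<alpha>, \<beta>}" for F \<alpha> \<beta>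
      proof -
        have ab_only: "c' f = a \<or> c' f = b" if "a \<in> c' ` F" "b \<in> c' ` F" "f \<in> F" for f
        proof -
          have "a \<in> {\<alpha>, \<beta>}" "b \<in> {\<alpha>, \<beta>}" "c' f \<in> {\<alpha>, \<beta>}" using that F(3) by blast+
          then show ?thesis using ab by auto
        qed
        have q_free: "q \<notin> e" if e: "e \<in> F" for e
        proof
          assume qe: "q \<in> e"
          obtain f where f: "f \<in> F" "f \<noteq> e" "q \<in> f" by (rule leaflessE[OF F(2) e qe])
          have m: "{q, p} \<in> F" "{q, z} \<in> F"
            using H_at_q[of e] H_at_q[of f] e qe f F(1) by auto
          then have im: "a \<in> c' ` F" "b \<in> c' ` F" using c'v by (metis imageI)+
          obtain h where h: "h \<in> F" "h \<noteq> {q, z}" "z \<in> h" by (rule leaflessE[OF F(2) m(2), of z]) auto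
          have hH: "h \<in> ?H" using h(1) F(1) by blast
          have "h \<notin> {{q, p}, {q, z}, {w, p}}" using h(2,3) z(1) zq zw by auto
          then have "c' h = c h" by (rule c'o)
          then show False using ab_only[OF im h(1)] at_z[OF hH h(3,2)] by simp
        qed
        have "{w, p} \<notin> F"
        proof
          assume m: "{w, p} \<in> F"
          obtain f where f: "f \<in> F" "f \<noteq> {w, p}" "w \<in> f" by (rule leaflessE[OF F(2) m, of w]) auto
          have "f = {w, r}" using H_at_w[of f] f F(1) by auto
          then have im: "a \<in> c' ` F" "b \<in> c' ` F" using c'v m f(1) by (metis imageI)+
          obtain h where h: "h \<in> F" "h \<noteq> {w, p}" "p \<in> h" by (rule leaflessE[OF F(2) m, of p]) auto
          have hH: "h \<in> ?H" using h(1) F(1) by blast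
          have hq: "h \<noteq> {q, p}" "h \<noteq> {q, z}" using q_free[OF h(1)] by auto
          then have "c' h = c h" using h(2) by (intro c'o) simp
          then show False using ab_only[OF im h(1)] at_p'[OF hH h(3) hq(1)] by simp
        qed
        then show ?thesis using q_free by auto
      qed
    qed
    then show False
    proof (rule finish)
      have "a \<in> c' ` {e \<in> E. p \<in> e}" "b \<in> c' ` {e \<in> E. p \<in> e}"
        using c'v qpE by (metis (mono_tags, lifting) image_eqI insertCI mem_Collect_eq)+
      then show "c' {q, u} \<in> c' ` {e \<in> E. p \<in> e}" if "u \<in> big q" "u \<noteq> p" for u
        using that z(2) c'v by auto
      show "c' {w, u} \<in> c' ` {e \<in> E. p \<in> e}" if "u \<in> big w" "u \<noteq> p" for u
        using \<open>b \<in> c' ` {e \<in> E. p \<in> e}\<close> that r(3) c'v by auto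
    qed
  qed
qed

end

section \<open>The bound on the acyclic chromatic index\<close>

lemma degenerate_subset:
  assumes "finite E" "degenerate k V E" "E' \<subseteq> E"
  shows "degenerate k V E'"
  unfolding degenerate_def
proof (intro allI impI)
  fix S assume "S \<subseteq> V \<and> S \<noteq> {}"
  then obtain v where v: "v \<in> S" "degree (induced_edges E S) v \<le> k"
    using assms(2) unfolding degenerate_def by blast
  have "degree (induced_edges E' S) v \<le> degree (induced_edges E S) v"
    by (rule degree_mono) (use assms(1,3) in \<open>auto simp: induced_edges_def\<close>)
  then show "\<exists>v\<in>S. degree (induced_edges E' S) v \<le> k" using v by force
qed

lemma two_degenerate_good:
  assumes "finite_simple_graph V E" "degenerate 2 V E" "finite C" "\<And>v. degree E v < card C"
  shows "\<exists>c. good E C c"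
  using assms
proof (induction "card E" arbitrary: E rule: less_induct)
  case less
  interpret finite_simple_graph V E by (rule less.prems(1))
  have IH: "\<exists>c. good (E - {e}) C c" if e: "e \<in> E" for e
  proof (rule less.hyps)
    show "card (E - {e}) < card E" by (rule card_Diff1_less[OF finite_E e])
    show "finite_simple_graph V (E - {e})" by unfold_locales (use finite_V edges in auto)
    show "degenerate 2 V (E - {e})" by (rule degenerate_subset[OF finite_E less.prems(2)]) blast
    show "finite C" by (rule less.prems(3))
    show "degree (E - {e}) v < card C" for v
      using degree_mono[OF finite_E, of "E - {e}" v] less.prems(4)[of v] by auto
  qed
  show ?case
  proof (rule ccontr)
    assume "\<not> ?case"
    then interpret uncolorable V E C
      by unfold_locales (use less.prems IH in auto)
    show False by (rule no_minimal_counterexample)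
  qed
qed

theorem theorem1:
  fixes V :: "'a set" and E :: "'a set set" and \<Delta> :: nat
  assumes "finite_simple_graph V E"
    and "degenerate 2 V E"
    and "max_degree V E = \<Delta>"
  shows "acyclic_chromatic_index E \<le> \<Delta> + 1
    \<and> (\<exists>c :: 'a set \<Rightarrow> nat. acyclic_edge_coloring E {..<\<Delta> + 1} c)"
proof -
  interpret finite_simple_graph V E by (rule assms(1))
  have "degree E v < card {..<\<Delta> + 1}" for v
  proof (cases "v \<in> V")
    case True
    then have "degree E v \<le> max_degree V E"
      unfolding max_degree_def using finite_V by (intro Max_ge) auto
    then show ?thesis using assms(3) by simp
  next
    case False
    then have "{e \<in> E. v \<in> e} = {}" using edges by blast
    then have "degree E v = 0" unfolding degree_def by (metis card.empty)
    then show ?thesis by simp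
  qed
  then obtain c :: "'a set \<Rightarrow> nat" where "good E {..<\<Delta> + 1} c"
    using two_degenerate_good[OF assms(1,2), of "{..<\<Delta> + 1}"] by auto
  then have c: "acyclic_edge_coloring E {..<\<Delta> + 1} c" by (rule good_imp_acyclic)
  then have "acyclic_chromatic_index E \<le> \<Delta> + 1"
    unfolding acyclic_chromatic_index_def by (intro Least_le) blast
  then show ?thesis using c by blast
qed

end
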